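(* Let $f$ be a discrete Morse-Bott function on a Lefschetz complex $\mathbb{K}=(X,\dim,w)$. Let $\mu,\kappa\in\mathbb{K}$ with $w(\mu,\kappa)\neq0$, and assume that $f(\sigma)=\dim\sigma$ for every cell $\sigma\in\mathbb{K}$ of dimension $\dim\mu$ or $\dim\kappa$. Put $\mathbb{K}_E=\mathbb{K}\{\mu,\kappa\}\sqcup E(\mu,\kappa)$. Then $f$ is a discrete Morse-Bott function on $\mathbb{K}_E$, $$P_t(\mathbb{K}_E)=P_t(\mathbb{K}),\qquad P_t\bigl(\mathbb{W}(\mathbb{K}_E,f)\bigr)=P_t\bigl(\mathbb{W}(\mathbb{K},f)\bigr),$$ and consequently $R_t(\mathbb{K},f)=R_t(\mathbb{K}_E,f)$.
   Context: A Lefschetz complex is a triple $\mathbb{K}=(X,\dim,w)$, where $X$ is a set (of cells), $\dim\colon X\to\mathbb{Z}_{\ge0}$ and $w\colon X\times X\to\mathbb{R}$ are functions, $\dim^{-1}(k)$ is finite for every $k$, and: (L1) $w(\tau,\sigma)\neq0$ implies $\dim\tau-\dim\sigma=1$; (L2) $\sum_{\sigma\in X}w(\tau,\sigma)w(\sigma,\nu)=0$ for all $\tau,\nu\in X$. The disjoint union $\mathbb{K}_1\sqcup\mathbb{K}_2$ has as cells the disjoint union of the cells, the given dimension and incidence functions on each summand, and incidence number $0$ between cells of distinct summands. $C_k(\mathbb{K})$ is the real vector space with basis the $k$-cells (cells of dimension $k$), $C_{-1}(\mathbb{K})=\{0\}$, $\partial_k(\tau)=\sum_\sigma w(\tau,\sigma)\sigma$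 for a $k$-cell $\tau$ (sum over $(k-1)$-cells), $B_k(\mathbb{K})=\operatorname{im}\partial_{k+1}$, $H_k(\mathbb{K})=\ker\partial_k/B_k(\mathbb{K})$, and $P_t(\mathbb{K})=\sum_{k\ge0}\operatorname{rank}H_k(\mathbb{K})\,t^k$. For $f\colon\mathbb{K}\to\mathbb{R}$ put $U^{\mathrm{snc}}(\sigma)=\#\{\tau\mid w(\tau,\sigma)\ne0,\ f(\sigma)>f(\tau)\}$, $D^{\mathrm{snc}}(\sigma)=\#\{\nu\mid w(\sigma,\nu)\ne0,\ f(\sigma)<f(\nu)\}$. $f$ is a discrete Morse-Bott function if $U^{\mathrm{snc}}(\sigma)\le1$ and $D^{\mathrm{snc}}(\sigma)\le1$ for all $\sigma$. A cell $\sigma$ is weakly critical if $U^{\mathrm{snc}}(\sigma)+D^{\mathrm{snc}}(\sigma)=0$. The weakly critical complex $\mathbb{W}(\mathbb{K},f)$ is the Lefschetz complex whose cells are the weakly critical cells, with the restricted dimension function and with incidence function equal to $w(\tau,\sigma)$ if $f(\tau)=f(\sigma)$ and $0$ otherwise. With $d_k^{\mathrm{snc}}(\mathbb{K},f)=\#\{k\text{-cells }\sigma\mid D^{\mathrm{snc}}(\sigma)=1\}$, $$R_t(\mathbb{K},f)=\sum_{k=1}^\infty\bigl(\operatorname{rank}B_{k-1}(\mathbb{K})-d_k^{\mathrm{snc}}(\mathbb{K},f)-\operatorname{rank}B_{k-1}(\mathbb{W}(\mathbb{K},f))\bigr)t^{k-1}.$$ For $\mu,\kappa\in\mathbb{K}$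 with $w(\mu,\kappa)\ne0$, $\mathbb{K}\{\mu,\kappa\}$ is the Lefschetz complex with cell set $X\setminus\{\mu,\kappa\}$, restricted dimension function, and incidence function $w'(\tau,\sigma)=w(\tau,\sigma)-\dfrac{w(\tau,\kappa)w(\mu,\sigma)}{w(\mu,\kappa)}$. The elementary block $E(\mu,\kappa)$ is the Lefschetz complex with exactly the two cells $\mu,\kappa$ (with their dimensions), incidence number $1$ at $(\mu,\kappa)$ and $0$ at all other pairs. Thus $\mathbb{K}_E$ has the same cell set $X$ as $\mathbb{K}$, and $f$ is a function on it. *)

theory Defs
  imports
    Complex_Main
    "HOL-Library.Function_Algebras"
    "HOL-Computational_Algebra.Formal_Power_Series"
    "HOL-Algebra.Module"
begin

subsection \<open>Lefschetz complexes\<close>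

text \<open>The fields \<open>cdim\<close> and \<open>inc\<close> are total functions; their values outside \<open>cells\<close> are
  irrelevant and never used.\<close>

record 'a complex_data =
  cells :: "'a set"
  cdim :: "'a \<Rightarrow> nat"
  inc :: "'a \<Rightarrow> 'a \<Rightarrow> real"

definition kcells :: "'a complex_data \<Rightarrow> nat \<Rightarrow> 'a set" where
  "kcells K k = {\<sigma> \<in> cells K. cdim K \<sigma> = k}"

text \<open>The set of cells may be infinite, and \<open>sum\<close> vanishes on infinite index sets. The sum in (L2)
  is therefore taken over its support, which is finite by (L1) and the finiteness of the sets of
  \<open>k\<close>-cells.\<close>

definition lefschetz_complex :: "'a complex_data \<Rightarrow> bool" where
  "lefschetz_complex K \<longleftrightarrow>
     (\<forall>k. finite (kcells K k)) \<and>
     (\<forall>\<tau>\<in>cells K. \<forall>\<sigma>\<in>cells K. inc K \<tau> \<sigma> \<noteq> 0 \<longrightarrow> int (cdim K \<tau>) - int (cdim K \<sigma>) = 1) \<and>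
     (\<forall>\<tau>\<in>cells K. \<forall>\<nu>\<in>cells K.
        (\<Sum>\<sigma> | \<sigma> \<in> cells K \<and> inc K \<tau> \<sigma> * inc K \<sigma> \<nu> \<noteq> 0. inc K \<tau> \<sigma> * inc K \<sigma> \<nu>) = 0)"

text \<open>Internal disjoint union, to be used only for complexes whose sets of cells are disjoint
  subsets of the same type.\<close>

definition disjoint_union :: "'a complex_data \<Rightarrow> 'a complex_data \<Rightarrow> 'a complex_data" where
  "disjoint_union K L =
     \<lparr>cells = cells K \<union> cells L,
      cdim = (\<lambda>\<sigma>. if \<sigma> \<in> cells K then cdim K \<sigma> else cdim L \<sigma>),
      inc = (\<lambda>\<tau> \<sigma>. if \<tau> \<in> cells K \<and> \<sigma> \<in> cells K then inc K \<tau> \<sigma>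
                   else if \<tau> \<in> cells L \<and> \<sigma> \<in> cells L then inc L \<tau> \<sigma>
                   else 0)\<rparr>"

definition cancel_pair :: "'a complex_data \<Rightarrow> 'a \<Rightarrow> 'a \<Rightarrow> 'a complex_data" where
  "cancel_pair K \<mu> \<kappa> =
     \<lparr>cells = cells K - {\<mu>, \<kappa>},
      cdim = cdim K,
      inc = (\<lambda>\<tau> \<sigma>. inc K \<tau> \<sigma> - inc K \<tau> \<kappa> * inc K \<mu> \<sigma> / inc K \<mu> \<kappa>)\<rparr>"

definition elementary_block :: "'a complex_data \<Rightarrow> 'a \<Rightarrow> 'a \<Rightarrow> 'a complex_data" where
  "elementary_block K \<mu> \<kappa> =
     \<lparr>cells = {\<mu>, \<kappa>},
      cdim = cdim K,
      inc = (\<lambda>\<tau> \<sigma>. if \<tau> = \<mu> \<and> \<sigma> = \<kappa> then 1 else 0)\<rparr>"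


subsection \<open>Chains and homology\<close>

instantiation "fun" :: (type, real_vector) real_vector
begin

definition scaleR_fun :: "real \<Rightarrow> ('a \<Rightarrow> 'b) \<Rightarrow> 'a \<Rightarrow> 'b" where
  "scaleR_fun r c = (\<lambda>x. r *\<^sub>R c x)"

instance
  by standard (auto simp: scaleR_fun_def scaleR_add_right scaleR_add_left)

end

definition cell_chain :: "'a \<Rightarrow> 'a \<Rightarrow> real" where
  "cell_chain \<sigma> = (\<lambda>\<tau>. if \<tau> = \<sigma> then 1 else 0)"

definition chains :: "'a complex_data \<Rightarrow> nat \<Rightarrow> ('a \<Rightarrow> real) set" where
  "chains K k = span (cell_chain ` kcells K k)"

text \<open>For \<open>k = 0\<close> the inner sum is empty, so \<open>boundary K 0\<close> is the zero map.\<close>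

definition boundary :: "'a complex_data \<Rightarrow> nat \<Rightarrow> ('a \<Rightarrow> real) \<Rightarrow> 'a \<Rightarrow> real" where
  "boundary K k c =
     (\<Sum>\<tau>\<in>kcells K k. c \<tau> *\<^sub>R
        (\<Sum>\<sigma> | \<sigma> \<in> cells K \<and> Suc (cdim K \<sigma>) = k. inc K \<tau> \<sigma> *\<^sub>R cell_chain \<sigma>))"

definition cycles :: "'a complex_data \<Rightarrow> nat \<Rightarrow> ('a \<Rightarrow> real) set" where
  "cycles K k = {c \<in> chains K k. boundary K k c = 0}"

definition boundaries :: "'a complex_data \<Rightarrow> nat \<Rightarrow> ('a \<Rightarrow> real) set" where
  "boundaries K k = boundary K (Suc k) ` chains K (Suc k)"

text \<open>The quotient of a subspace \<open>V\<close> by a subspace \<open>W \<subseteq> V\<close>, as a vector space of cosets. The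
  summand \<open>w\<close> in the scalar multiplication makes \<open>0\<close> times a coset equal to \<open>W\<close>, not to \<open>{0}\<close>. The
  record fields \<open>mult\<close> and \<open>one\<close> play no role in a module.\<close>

definition quotient_space :: "'v::real_vector set \<Rightarrow> 'v set \<Rightarrow> (real, 'v set) module" where
  "quotient_space V W =
     \<lparr>carrier = (\<lambda>v. {v + w | w. w \<in> W}) ` V,
      mult = undefined,
      one = undefined,
      zero = W,
      add = (\<lambda>A B. {a + b | a b. a \<in> A \<and> b \<in> B}),
      smult = (\<lambda>r A. {r *\<^sub>R a + w | a w. a \<in> A \<and> w \<in> W})\<rparr>"

definition finite_basis :: "(real, 'v) module \<Rightarrow> 'v set \<Rightarrow> bool" where
  "finite_basis M A \<longleftrightarrow>
     finite A \<and> A \<subseteq> carrier M \<and>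
     (\<forall>x\<in>carrier M. \<exists>!a. a \<in> A \<rightarrow>\<^sub>E UNIV \<and> x = (\<Oplus>\<^bsub>M\<^esub>v\<in>A. a v \<odot>\<^bsub>M\<^esub> v))"

definition module_rank :: "(real, 'v) module \<Rightarrow> nat" where
  "module_rank M = (THE n. \<exists>A. finite_basis M A \<and> card A = n)"

definition homology :: "'a complex_data \<Rightarrow> nat \<Rightarrow> (real, ('a \<Rightarrow> real) set) module" where
  "homology K k = quotient_space (cycles K k) (boundaries K k)"

definition poincare_series :: "'a complex_data \<Rightarrow> int fps" where
  "poincare_series K = Abs_fps (\<lambda>k. int (module_rank (homology K k)))"


subsection \<open>Discrete Morse-Bott functions\<close>

definition U_snc :: "'a complex_data \<Rightarrow> ('a \<Rightarrow> real) \<Rightarrow> 'a \<Rightarrow> nat" where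
  "U_snc K f \<sigma> = card {\<tau> \<in> cells K. inc K \<tau> \<sigma> \<noteq> 0 \<and> f \<sigma> > f \<tau>}"

definition D_snc :: "'a complex_data \<Rightarrow> ('a \<Rightarrow> real) \<Rightarrow> 'a \<Rightarrow> nat" where
  "D_snc K f \<sigma> = card {\<nu> \<in> cells K. inc K \<sigma> \<nu> \<noteq> 0 \<and> f \<sigma> < f \<nu>}"

definition discrete_morse_bott :: "'a complex_data \<Rightarrow> ('a \<Rightarrow> real) \<Rightarrow> bool" where
  "discrete_morse_bott K f \<longleftrightarrow>
     lefschetz_complex K \<and> (\<forall>\<sigma>\<in>cells K. U_snc K f \<sigma> \<le> 1 \<and> D_snc K f \<sigma> \<le> 1)"

definition weakly_critical :: "'a complex_data \<Rightarrow> ('a \<Rightarrow> real) \<Rightarrow> 'a \<Rightarrow> bool" where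
  "weakly_critical K f \<sigma> \<longleftrightarrow> U_snc K f \<sigma> + D_snc K f \<sigma> = 0"

definition weakly_critical_complex :: "'a complex_data \<Rightarrow> ('a \<Rightarrow> real) \<Rightarrow> 'a complex_data" where
  "weakly_critical_complex K f =
     \<lparr>cells = {\<sigma> \<in> cells K. weakly_critical K f \<sigma>},
      cdim = cdim K,
      inc = (\<lambda>\<tau> \<sigma>. if f \<tau> = f \<sigma> then inc K \<tau> \<sigma> else 0)\<rparr>"

definition d_snc :: "'a complex_data \<Rightarrow> ('a \<Rightarrow> real) \<Rightarrow> nat \<Rightarrow> nat" where
  "d_snc K f k = card {\<sigma> \<in> kcells K k. D_snc K f \<sigma> = 1}"

text \<open>The coefficient at \<open>j\<close> is the summand for \<open>k = Suc j\<close> in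
  \<open>\<Sum>k\<ge>1. (rank B (k - 1) - d k - rank B\<^sub>W (k - 1)) t ^ (k - 1)\<close>.\<close>

definition remainder_series :: "'a complex_data \<Rightarrow> ('a \<Rightarrow> real) \<Rightarrow> int fps" where
  "remainder_series K f =
     Abs_fps (\<lambda>j. int (dim (boundaries K j)) - int (d_snc K f (Suc j))
                   - int (dim (boundaries (weakly_critical_complex K f) j)))"

end

theory Submission
  imports Defs
begin

text \<open>
  Passing from \<open>K\<close> to \<open>K\<^sub>E\<close> is a change of basis in two chain groups. Among the cells of dimension
  \<open>dim \<mu>\<close>, every \<open>\<tau> \<noteq> \<mu>\<close> is replaced by \<open>\<tau> - (w(\<tau>,\<kappa>) / w(\<mu>,\<kappa>)) \<mu>\<close>, whose boundary does not
  contain \<open>\<kappa>\<close>; among the cells of dimension \<open>dim \<kappa>\<close>, the cell \<open>\<kappa>\<close> is replaced by \<open>\<partial>\<mu>\<close>. In the new basis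
  the boundary operator of \<open>K\<close> has the incidence numbers of \<open>K\<^sub>E\<close>: the entries between the two
  dimensions are those of one step of Gaussian elimination, the row of \<open>\<partial>\<mu>\<close> vanishes because
  \<open>\<partial>\<partial> = 0\<close>, and so does the column of \<open>\<mu>\<close>, again by \<open>\<partial>\<partial> = 0\<close>. The linear map
  \<open>basis_change\<close>, which sends each cell to its new basis vector, is therefore a chain isomorphism from
  \<open>K\<^sub>E\<close> to \<open>K\<close>, and \<open>K\<^sub>E\<close> inherits \<open>\<partial>\<partial> = 0\<close> through it.

  For the Morse-Bott part, a nonzero path \<open>\<tau>, \<sigma>, \<nu>\<close> of incidences never comes alone: since the
  products of incidence numbers over all middle cells sum to zero, there is another
  middle cell \<open>\<sigma>'\<close> (lemma \<open>second_path\<close>). If \<open>\<sigma>\<close> is a face of \<open>\<mu>\<close>, then \<open>f\<close> agrees on \<open>\<sigma>\<close> and \<open>\<sigma>'\<close>, so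
  \<open>f(\<sigma>) < f(\<nu>)\<close> would give \<open>\<nu>\<close> two cofaces with smaller value, against \<open>U(\<nu>) \<le> 1\<close>.
  Together with the dual argument for cofaces of \<open>\<kappa>\<close> this has two consequences. No incidence number
  between a cell of smaller value and a face of larger value changes, so \<open>U\<close>, \<open>D\<close> and the set of
  weakly critical cells are the same for \<open>K\<close> and \<open>K\<^sub>E\<close>. And all faces of \<open>\<mu>\<close> and all cofaces of \<open>\<kappa>\<close>
  are weakly critical, so the same change of basis lives on the weakly critical complexes. It
  commutes with their boundaries because discarding incidences between different values of \<open>f\<close>
  treats all cells that are mixed by the change of basis alike: they have equal dimension, hence
  equal value.

  A chain isomorphism preserves homology and the dimension of the spaces of boundaries, and all four
  claims follow. The two complexes \<open>K\<close> and \<open>W(K,f)\<close> are handled at once by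
  the locale \<open>incident_pair_level\<close>.
\<close>

section \<open>Ranks of isomorphic real modules\<close>

text \<open>A basis is described by finite linear combinations. For \<open>h\<close> to commute with these, addition must
  be that of an abelian monoid and scalar multiplication must stay inside the carrier.\<close>

definition real_module_iso :: "('v \<Rightarrow> 'w) \<Rightarrow> (real, 'v) module \<Rightarrow> (real, 'w) module \<Rightarrow> bool" where
  "real_module_iso h M N \<longleftrightarrow>
     abelian_monoid M \<and> abelian_monoid N \<and> bij_betw h (carrier M) (carrier N) \<and>
     (\<forall>x\<in>carrier M. \<forall>r. r \<odot>\<^bsub>M\<^esub> x \<in> carrier M \<and> h (r \<odot>\<^bsub>M\<^esub> x) = r \<odot>\<^bsub>N\<^esub> h x) \<and>
     (\<forall>x\<in>carrier M. \<forall>y\<in>carrier M. h (x \<oplus>\<^bsub>M\<^esub> y) = h x \<oplus>\<^bsub>N\<^esub> h y) \<and>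
     h \<zero>\<^bsub>M\<^esub> = \<zero>\<^bsub>N\<^esub>"

lemma real_module_iso_inv:
  assumes "real_module_iso h M N"
  shows "real_module_iso (inv_into (carrier M) h) N M"
proof -
  interpret M: abelian_monoid M using assms by (simp add: real_module_iso_def)
  have bij: "bij_betw h (carrier M) (carrier N)" using assms by (simp add: real_module_iso_def)
  define g where "g = inv_into (carrier M) h"
  have gh: "g (h x) = x" if "x \<in> carrier M" for x
    using that bij by (simp add: g_def bij_betw_inv_into_left)
  have ex: "\<exists>x\<in>carrier M. y = h x" if "y \<in> carrier N" for y
    using that bij by (auto simp: bij_betw_def)
  have sm: "r \<odot>\<^bsub>M\<^esub> x \<in> carrier M" "h (r \<odot>\<^bsub>M\<^esub> x) = r \<odot>\<^bsub>N\<^esub> h x" if "x \<in> carrier M" for r x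
    using assms that by (auto simp: real_module_iso_def)
  have ad: "h (x \<oplus>\<^bsub>M\<^esub> y) = h x \<oplus>\<^bsub>N\<^esub> h y" if "x \<in> carrier M" "y \<in> carrier M" for x y
    using assms that by (auto simp: real_module_iso_def)
  have "h x \<in> carrier N" if "x \<in> carrier M" for x
    using bij that by (auto simp: bij_betw_def)
  then have 1: "r \<odot>\<^bsub>N\<^esub> y \<in> carrier N \<and> g (r \<odot>\<^bsub>N\<^esub> y) = r \<odot>\<^bsub>M\<^esub> g y" if "y \<in> carrier N" for r y
    using ex[OF that] by (metis gh sm)
  have 2: "g (x \<oplus>\<^bsub>N\<^esub> y) = g x \<oplus>\<^bsub>M\<^esub> g y" if "x \<in> carrier N" "y \<in> carrier N" for x y
    using ex[OF that(1)] ex[OF that(2)] by (metis gh ad M.a_closed)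
  have 3: "g \<zero>\<^bsub>N\<^esub> = \<zero>\<^bsub>M\<^esub>"
    using assms gh[OF M.zero_closed] by (simp add: real_module_iso_def)
  show ?thesis
    using assms 1 2 3 bij_betw_inv_into[OF bij] unfolding real_module_iso_def g_def by blast
qed

lemma finite_basis_image:
  assumes iso: "real_module_iso h M N" and A: "finite_basis M A"
  shows "finite_basis N (h ` A) \<and> card (h ` A) = card A"
proof -
  interpret M: abelian_monoid M using iso by (simp add: real_module_iso_def)
  interpret N: abelian_monoid N using iso by (simp add: real_module_iso_def)
  have bij: "bij_betw h (carrier M) (carrier N)" using iso by (simp add: real_module_iso_def)
  have finA: "finite A" and AM: "A \<subseteq> carrier M"
    and uniq: "\<And>x. x \<in> carrier M \<Longrightarrow>
       \<exists>!a. a \<in> A \<rightarrow>\<^sub>E UNIV \<and> x = (\<Oplus>\<^bsub>M\<^esub>v\<in>A. a v \<odot>\<^bsub>M\<^esub> v)"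
    using A by (auto simp: finite_basis_def)
  have sm: "r \<odot>\<^bsub>M\<^esub> x \<in> carrier M" "h (r \<odot>\<^bsub>M\<^esub> x) = r \<odot>\<^bsub>N\<^esub> h x" if "x \<in> carrier M" for r x
    using iso that by (auto simp: real_module_iso_def)
  have ad: "h (x \<oplus>\<^bsub>M\<^esub> y) = h x \<oplus>\<^bsub>N\<^esub> h y" if "x \<in> carrier M" "y \<in> carrier M" for x y
    using iso that by (auto simp: real_module_iso_def)
  have hN: "h x \<in> carrier N" if "x \<in> carrier M" for x
    using bij that by (auto simp: bij_betw_def)
  have smN: "r \<odot>\<^bsub>N\<^esub> h x \<in> carrier N" if "x \<in> carrier M" for r x
    using that sm hN by metis
  have injA: "inj_on h A" using bij AM by (meson bij_betw_def inj_on_subset)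
  have h_sum: "h (\<Oplus>\<^bsub>M\<^esub>v\<in>B. a v \<odot>\<^bsub>M\<^esub> v) = (\<Oplus>\<^bsub>N\<^esub>v\<in>B. a v \<odot>\<^bsub>N\<^esub> h v)"
    if "finite B" "B \<subseteq> carrier M" for B a
    using that
  proof (induction B)
    case empty
    then show ?case using iso by (simp add: real_module_iso_def)
  next
    case (insert u B)
    then have "(\<lambda>v. a v \<odot>\<^bsub>M\<^esub> v) \<in> B \<rightarrow> carrier M" "a u \<odot>\<^bsub>M\<^esub> u \<in> carrier M"
      "(\<lambda>v. a v \<odot>\<^bsub>N\<^esub> h v) \<in> B \<rightarrow> carrier N" "a u \<odot>\<^bsub>N\<^esub> h u \<in> carrier N"
      using sm smN by auto
    then show ?case using insert by (simp add: ad sm)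
  qed
  have sum_image: "(\<Oplus>\<^bsub>N\<^esub>v\<in>h ` A. b v \<odot>\<^bsub>N\<^esub> v) = h (\<Oplus>\<^bsub>M\<^esub>u\<in>A. restrict (b \<circ> h) A u \<odot>\<^bsub>M\<^esub> u)" for b
  proof -
    have "(\<Oplus>\<^bsub>N\<^esub>v\<in>h ` A. b v \<odot>\<^bsub>N\<^esub> v) = (\<Oplus>\<^bsub>N\<^esub>u\<in>A. b (h u) \<odot>\<^bsub>N\<^esub> h u)"
      using N.finsum_reindex[OF _ injA, of "\<lambda>v. b v \<odot>\<^bsub>N\<^esub> v"] smN AM by auto
    also have "\<dots> = (\<Oplus>\<^bsub>N\<^esub>u\<in>A. restrict (b \<circ> h) A u \<odot>\<^bsub>N\<^esub> h u)"
      using smN AM by (intro N.finsum_cong) (auto simp: simp_implies_def)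
    finally show ?thesis using h_sum[OF finA AM] by simp
  qed
  have M_sum: "(\<Oplus>\<^bsub>M\<^esub>u\<in>A. a u \<odot>\<^bsub>M\<^esub> u) \<in> carrier M" for a
    using sm AM by (intro M.finsum_closed) auto
  have "\<exists>!b. b \<in> h ` A \<rightarrow>\<^sub>E UNIV \<and> y = (\<Oplus>\<^bsub>N\<^esub>v\<in>h ` A. b v \<odot>\<^bsub>N\<^esub> v)" if y: "y \<in> carrier N" for y
  proof -
    obtain x where x: "x \<in> carrier M" "y = h x"
      using y bij_betw_imp_surj_on[OF bij] by blast
    have y_iff: "y = (\<Oplus>\<^bsub>N\<^esub>v\<in>h ` A. b v \<odot>\<^bsub>N\<^esub> v)
        \<longleftrightarrow> x = (\<Oplus>\<^bsub>M\<^esub>u\<in>A. restrict (b \<circ> h) A u \<odot>\<^bsub>M\<^esub> u)" for b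
      unfolding sum_image x(2)
      by (rule inj_on_eq_iff[OF bij_betw_imp_inj_on[OF bij] x(1) M_sum])
    from uniq[OF x(1)] obtain a
      where a: "a \<in> A \<rightarrow>\<^sub>E UNIV \<and> x = (\<Oplus>\<^bsub>M\<^esub>u\<in>A. a u \<odot>\<^bsub>M\<^esub> u)"
        and a_uniq: "\<forall>a'. a' \<in> A \<rightarrow>\<^sub>E UNIV \<and> x = (\<Oplus>\<^bsub>M\<^esub>u\<in>A. a' u \<odot>\<^bsub>M\<^esub> u) \<longrightarrow> a' = a"
      by (rule ex1E)
    define b where "b = restrict (a \<circ> inv_into A h) (h ` A)"
    have "restrict (b \<circ> h) A = a"
    proof
      fix u
      show "restrict (b \<circ> h) A u = a u"
        using injA PiE_arb[OF conjunct1[OF a], of u] by (cases "u \<in> A") (simp_all add: b_def)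
    qed
    then have "y = (\<Oplus>\<^bsub>N\<^esub>v\<in>h ` A. b v \<odot>\<^bsub>N\<^esub> v)"
      using conjunct2[OF a] by (subst y_iff) (simp only:)
    moreover have "b' = b" if b': "b' \<in> h ` A \<rightarrow>\<^sub>E UNIV" "y = (\<Oplus>\<^bsub>N\<^esub>v\<in>h ` A. b' v \<odot>\<^bsub>N\<^esub> v)" for b'
    proof -
      have "restrict (b' \<circ> h) A = a"
        using iffD1[OF y_iff b'(2)] by (intro a_uniq[rule_format] conjI) simp_all
      then have "b' (h u) = a u" if "u \<in> A" for u
        using that by (simp add: fun_eq_iff restrict_def split: if_splits)
      then have on: "b' v = b v" if "v \<in> h ` A" for v
        using that injA by (auto simp: b_def)
      show ?thesis
      proof
        fix v
        show "b' v = b v"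
          using on PiE_arb[OF b'(1), of v] by (cases "v \<in> h ` A") (simp_all add: b_def)
      qed
    qed
    moreover have "b \<in> h ` A \<rightarrow>\<^sub>E UNIV" by (simp add: b_def)
    ultimately show ?thesis by (intro ex1I[of _ b]) simp_all
  qed
  moreover have "h ` A \<subseteq> carrier N" using AM hN by blast
  ultimately show ?thesis
    using finA unfolding finite_basis_def by (simp add: card_image[OF injA])
qed

text \<open>Isomorphic modules have bases of the same cardinalities. Hence the descriptions that define
  the two ranks are satisfied by the same numbers.\<close>

lemma module_rank_iso:
  assumes "real_module_iso h M N"
  shows "module_rank M = module_rank N"
proof -
  have "(\<exists>A. finite_basis M A \<and> card A = n) \<longleftrightarrow> (\<exists>A. finite_basis N A \<and> card A = n)" for n
    using finite_basis_image[OF assms] finite_basis_image[OF real_module_iso_inv[OF assms]]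
    by metis
  then show ?thesis by (simp add: module_rank_def)
qed


section \<open>Injective linear images of quotient spaces\<close>

lemma quotient_add:
  assumes "subspace W"
  shows "{a + w | w. w \<in> W} \<oplus>\<^bsub>quotient_space V W\<^esub> {b + w | w. w \<in> W} = {a + b + w | w. w \<in> W}"
proof (intro Set.set_eqI iffI)
  fix x assume "x \<in> {a + w | w. w \<in> W} \<oplus>\<^bsub>quotient_space V W\<^esub> {b + w | w. w \<in> W}"
  then obtain w w' where "w \<in> W" "w' \<in> W" "x = (a + w) + (b + w')"
    by (auto simp: quotient_space_def)
  then have "x = a + b + (w + w')" "w + w' \<in> W" using assms by (auto simp: subspace_add)
  then show "x \<in> {a + b + w | w. w \<in> W}" by blast
next
  fix x assume "x \<in> {a + b + w | w. w \<in> W}"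
  then obtain w where "w \<in> W" "x = (a + w) + (b + 0)" by (auto simp: add_ac)
  then show "x \<in> {a + w | w. w \<in> W} \<oplus>\<^bsub>quotient_space V W\<^esub> {b + w | w. w \<in> W}"
    using subspace_0[OF assms] unfolding quotient_space_def by fastforce
qed

lemma quotient_smult:
  assumes "subspace W"
  shows "r \<odot>\<^bsub>quotient_space V W\<^esub> {a + w | w. w \<in> W} = {r *\<^sub>R a + w | w. w \<in> W}"
proof (intro Set.set_eqI iffI)
  fix x assume "x \<in> r \<odot>\<^bsub>quotient_space V W\<^esub> {a + w | w. w \<in> W}"
  then obtain w w' where "w \<in> W" "w' \<in> W" "x = r *\<^sub>R (a + w) + w'"
    by (auto simp: quotient_space_def)
  then have "x = r *\<^sub>R a + (r *\<^sub>R w + w')" "r *\<^sub>R w + w' \<in> W"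
    using assms by (auto simp: subspace_add subspace_scale algebra_simps)
  then show "x \<in> {r *\<^sub>R a + w | w. w \<in> W}" by blast
next
  fix x assume "x \<in> {r *\<^sub>R a + w | w. w \<in> W}"
  then obtain w where "w \<in> W" "x = r *\<^sub>R (a + 0) + w" by auto
  then show "x \<in> r \<odot>\<^bsub>quotient_space V W\<^esub> {a + w | w. w \<in> W}"
    using subspace_0[OF assms] unfolding quotient_space_def by fastforce
qed

lemma quotient_carrier:
  "carrier (quotient_space V W) = (\<lambda>v. {v + w | w. w \<in> W}) ` V"
  by (simp add: quotient_space_def)

lemma quotient_zero: "\<zero>\<^bsub>quotient_space V W\<^esub> = {0 + w | w. w \<in> W}"
  by (simp add: quotient_space_def)

lemma abelian_monoid_quotient:
  assumes V: "subspace V" and W: "subspace W"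
  shows "abelian_monoid (quotient_space V W)"
proof (rule abelian_monoidI)
  let ?Q = "quotient_space V W"
  show "\<zero>\<^bsub>?Q\<^esub> \<in> carrier ?Q"
    unfolding quotient_zero quotient_carrier using subspace_0[OF V] by (rule imageI)
next
  let ?Q = "quotient_space V W"
  fix X Y Z assume "X \<in> carrier ?Q" "Y \<in> carrier ?Q" "Z \<in> carrier ?Q"
  then obtain x y z where v: "x \<in> V" "y \<in> V" and
    eqs: "X = {x + w | w. w \<in> W}" "Y = {y + w | w. w \<in> W}" "Z = {z + w | w. w \<in> W}"
    unfolding quotient_carrier by blast
  show "X \<oplus>\<^bsub>?Q\<^esub> Y \<in> carrier ?Q"
    unfolding eqs quotient_add[OF W] quotient_carrier using subspace_add[OF V v] by (rule imageI)
  show "X \<oplus>\<^bsub>?Q\<^esub> Y \<oplus>\<^bsub>?Q\<^esub> Z = X \<oplus>\<^bsub>?Q\<^esub> (Y \<oplus>\<^bsub>?Q\<^esub> Z)"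
    unfolding eqs quotient_add[OF W] by (simp only: add.assoc)
  show "X \<oplus>\<^bsub>?Q\<^esub> Y = Y \<oplus>\<^bsub>?Q\<^esub> X"
    unfolding eqs quotient_add[OF W] add.commute[of x y] ..
  show "\<zero>\<^bsub>?Q\<^esub> \<oplus>\<^bsub>?Q\<^esub> X = X"
    unfolding eqs quotient_zero quotient_add[OF W] by (simp only: add_0_left)
qed

text \<open>The isomorphism is the image map on cosets.\<close>

lemma module_rank_quotient_image:
  assumes \<phi>: "linear \<phi>" "inj \<phi>" and V: "subspace V" and W: "subspace W"
  shows "module_rank (quotient_space (\<phi> ` V) (\<phi> ` W)) = module_rank (quotient_space V W)"
proof -
  let ?M = "quotient_space V W" and ?N = "quotient_space (\<phi> ` V) (\<phi> ` W)"
  have V': "subspace (\<phi> ` V)" and W': "subspace (\<phi> ` W)"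
    using V W \<phi>(1) by (auto intro: linear_subspace_image)
  have coset: "\<phi> ` {v + w | w. w \<in> W} = {\<phi> v + w | w. w \<in> \<phi> ` W}" for v
    by (simp only: Setcompr_eq_image image_image linear_add[OF \<phi>(1)])
  have "inj_on (image \<phi>) (carrier ?M)"
    by (rule inj_onI) (simp only: inj_image_eq_iff[OF \<phi>(2)])
  moreover have "image \<phi> ` carrier ?M = carrier ?N"
    by (simp only: quotient_carrier image_image coset)
  ultimately have bij: "bij_betw (image \<phi>) (carrier ?M) (carrier ?N)"
    by (simp add: bij_betw_def)
  have sm: "r \<odot>\<^bsub>?M\<^esub> X \<in> carrier ?M \<and> \<phi> ` (r \<odot>\<^bsub>?M\<^esub> X) = r \<odot>\<^bsub>?N\<^esub> (\<phi> ` X)" if X: "X \<in> carrier ?M" for r X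
  proof -
    obtain v where v: "v \<in> V" "X = {v + w | w. w \<in> W}" using X unfolding quotient_carrier by blast
    have "r \<odot>\<^bsub>?M\<^esub> X \<in> carrier ?M"
      unfolding v(2) quotient_smult[OF W] quotient_carrier
      using subspace_scale[OF V v(1)] by (rule imageI)
    moreover have "\<phi> ` (r \<odot>\<^bsub>?M\<^esub> X) = r \<odot>\<^bsub>?N\<^esub> (\<phi> ` X)"
      unfolding v(2) quotient_smult[OF W] coset quotient_smult[OF W'] linear_scale[OF \<phi>(1)] ..
    ultimately show ?thesis ..
  qed
  have ad: "\<phi> ` (X \<oplus>\<^bsub>?M\<^esub> Y) = (\<phi> ` X) \<oplus>\<^bsub>?N\<^esub> (\<phi> ` Y)" if XY: "X \<in> carrier ?M" "Y \<in> carrier ?M" for X Y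
  proof -
    obtain v v' where v: "X = {v + w | w. w \<in> W}" "Y = {v' + w | w. w \<in> W}"
      using XY unfolding quotient_carrier by blast
    show ?thesis
      unfolding v coset quotient_add[OF W] quotient_add[OF W'] linear_add[OF \<phi>(1)] ..
  qed
  have "\<phi> ` \<zero>\<^bsub>?M\<^esub> = \<zero>\<^bsub>?N\<^esub>"
    unfolding quotient_zero coset linear_0[OF \<phi>(1)] ..
  then have "real_module_iso (image \<phi>) ?M ?N"
    unfolding real_module_iso_def
    by (intro conjI ballI allI bij ad sm[THEN conjunct1] sm[THEN conjunct2]
        abelian_monoid_quotient V W V' W')
  from module_rank_iso[OF this] show ?thesis by (rule sym)
qed

section \<open>Chains and boundaries in coordinates\<close>

lemma cell_chain_apply: "cell_chain \<sigma> x = (if x = \<sigma> then 1 else 0)"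
  by (simp add: cell_chain_def)

lemma sum_apply: "(\<Sum>i\<in>A. f i) x = (\<Sum>i\<in>A. f i x :: 'b::comm_monoid_add)"
  by (induction A rule: infinite_finite_induct) auto

lemma chain_eq_sum_cell_chain:
  assumes "finite S" "\<And>x. c x \<noteq> 0 \<Longrightarrow> x \<in> S"
  shows "c = (\<Sum>\<sigma>\<in>S. c \<sigma> *\<^sub>R cell_chain \<sigma>)"
proof
  fix x
  have "(\<Sum>\<sigma>\<in>S. c \<sigma> *\<^sub>R cell_chain \<sigma>) x = (\<Sum>\<sigma>\<in>S. if x = \<sigma> then c \<sigma> else 0)"
    by (simp add: sum_apply scaleR_fun_def cell_chain_apply if_distrib cong: if_cong)
  also have "\<dots> = c x" using assms by (auto simp: sum.delta')
  finally show "c x = (\<Sum>\<sigma>\<in>S. c \<sigma> *\<^sub>R cell_chain \<sigma>) x" by simp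
qed

lemma chains_iff:
  assumes "finite (kcells K k)"
  shows "c \<in> chains K k \<longleftrightarrow> (\<forall>x. c x \<noteq> 0 \<longrightarrow> x \<in> kcells K k)"
proof
  assume "\<forall>x. c x \<noteq> 0 \<longrightarrow> x \<in> kcells K k"
  with chain_eq_sum_cell_chain[OF assms, of c] show "c \<in> chains K k"
    unfolding chains_def by (metis (no_types, lifting) imageI span_base span_scale span_sum)
next
  let ?S = "{c :: 'a \<Rightarrow> real. \<forall>x. c x \<noteq> 0 \<longrightarrow> x \<in> kcells K k}"
  assume c: "c \<in> chains K k"
  have "chains K k \<subseteq> ?S"
    unfolding chains_def
  proof (rule span_minimal)
    show "cell_chain ` kcells K k \<subseteq> ?S"
      by (auto simp: cell_chain_apply split: if_splits)
    show "subspace ?S"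
      unfolding subspace_def by (auto simp: scaleR_fun_def) (metis add_0)
  qed
  with c show "\<forall>x. c x \<noteq> 0 \<longrightarrow> x \<in> kcells K k" by blast
qed

lemma boundary_apply:
  assumes "\<And>j. finite (kcells K j)"
  shows "boundary K k c x =
    (if x \<in> cells K \<and> Suc (cdim K x) = k then \<Sum>\<tau>\<in>kcells K k. c \<tau> * inc K \<tau> x else 0)"
proof -
  let ?F = "{\<sigma> \<in> cells K. Suc (cdim K \<sigma>) = k}"
  have "?F \<subseteq> kcells K (k - 1)" by (auto simp: kcells_def)
  then have fin: "finite ?F" using assms finite_subset by blast
  have "boundary K k c x
      = (\<Sum>\<tau>\<in>kcells K k. c \<tau> * (\<Sum>\<sigma>\<in>?F. if x = \<sigma> then inc K \<tau> \<sigma> else 0))"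
    unfolding boundary_def
    by (simp add: sum_apply scaleR_fun_def cell_chain_apply if_distrib cong: if_cong)
  also have "\<dots> = (if x \<in> ?F then \<Sum>\<tau>\<in>kcells K k. c \<tau> * inc K \<tau> x else 0)"
    using fin by (auto simp: sum.delta')
  finally show ?thesis by simp
qed

lemma linear_boundary: "linear (boundary K k)"
  unfolding boundary_def
  by (rule linearI; rule ext)
    (simp_all add: sum_apply scaleR_fun_def distrib_right sum.distrib sum_distrib_left mult.assoc)

lemma boundary_in_chains:
  assumes "\<And>j. finite (kcells K j)"
  shows "boundary K (Suc k) c \<in> chains K k"
  using assms by (simp add: chains_iff boundary_apply kcells_def split: if_splits)


lemma boundary_cell_chain:
  assumes "\<And>j. finite (kcells K j)" "\<tau> \<in> kcells K k"
  shows "boundary K k (cell_chain \<tau>) x =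
    (if x \<in> cells K \<and> Suc (cdim K x) = k then inc K \<tau> x else 0)"
proof -
  have "(\<Sum>\<sigma>\<in>kcells K k. cell_chain \<tau> \<sigma> * inc K \<sigma> x)
      = (\<Sum>\<sigma>\<in>kcells K k. if \<sigma> = \<tau> then inc K \<tau> x else 0)"
    by (intro sum.cong) (auto simp: cell_chain_apply)
  also have "\<dots> = inc K \<tau> x" using assms by (simp add: sum.delta)
  finally show ?thesis by (simp add: boundary_apply[OF assms(1)])
qed

lemma subspace_chains: "subspace (chains K k)"
  by (simp add: chains_def)

lemma subspace_boundaries: "subspace (boundaries K k)"
  unfolding boundaries_def by (intro linear_subspace_image linear_boundary subspace_chains)

lemma subspace_cycles: "subspace (cycles K k)"
proof -
  have "cycles K k = chains K k \<inter> {c. boundary K k c = 0}" by (auto simp: cycles_def)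
  then show ?thesis
    using subspace_inter[OF subspace_chains linear_subspace_kernel[OF linear_boundary]] by metis
qed

text \<open>Only cells one dimension above \<open>\<nu>\<close> can contribute to the sum in (L2), so it may be taken over the
  finite set of these cells, which does not depend on \<open>\<tau>\<close>.\<close>

lemma composition_sum_eq:
  assumes fin: "\<And>j. finite (kcells K j)"
    and L1: "\<And>\<tau> \<sigma>. \<tau> \<in> cells K \<Longrightarrow> \<sigma> \<in> cells K \<Longrightarrow> inc K \<tau> \<sigma> \<noteq> 0 \<Longrightarrow> cdim K \<tau> = Suc (cdim K \<sigma>)"
    and \<nu>: "\<nu> \<in> cells K"
  shows "(\<Sum>\<sigma> | \<sigma> \<in> cells K \<and> inc K \<tau> \<sigma> * inc K \<sigma> \<nu> \<noteq> 0. inc K \<tau> \<sigma> * inc K \<sigma> \<nu>)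
    = (\<Sum>\<sigma>\<in>kcells K (Suc (cdim K \<nu>)). inc K \<tau> \<sigma> * inc K \<sigma> \<nu>)"
  using fin L1[OF _ \<nu>] by (intro sum.mono_neutral_left) (auto simp: kcells_def)

text \<open>(L2) is the entrywise form of \<open>\<partial>\<partial> = 0\<close>. The operator form is the one that can be transported
  along a chain isomorphism.\<close>

lemma lefschetz_complex_iff_boundary_boundary:
  "lefschetz_complex K \<longleftrightarrow>
     (\<forall>k. finite (kcells K k)) \<and>
     (\<forall>\<tau>\<in>cells K. \<forall>\<sigma>\<in>cells K. inc K \<tau> \<sigma> \<noteq> 0 \<longrightarrow> cdim K \<tau> = Suc (cdim K \<sigma>)) \<and>
     (\<forall>k. \<forall>c\<in>chains K (Suc (Suc k)). boundary K (Suc k) (boundary K (Suc (Suc k)) c) = 0)"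
  (is "_ \<longleftrightarrow> ?F \<and> ?L1 \<and> ?D")
proof -
  let ?L2 = "\<forall>\<tau>\<in>cells K. \<forall>\<nu>\<in>cells K.
    (\<Sum>\<sigma> | \<sigma> \<in> cells K \<and> inc K \<tau> \<sigma> * inc K \<sigma> \<nu> \<noteq> 0. inc K \<tau> \<sigma> * inc K \<sigma> \<nu>) = 0"
  have "int (cdim K \<tau>) - int (cdim K \<sigma>) = 1 \<longleftrightarrow> cdim K \<tau> = Suc (cdim K \<sigma>)" for \<tau> \<sigma>
    by auto
  then have def: "lefschetz_complex K \<longleftrightarrow> ?F \<and> ?L1 \<and> ?L2"
    by (simp add: lefschetz_complex_def)
  have "?L2 \<longleftrightarrow> ?D" if F: ?F and L1: ?L1
  proof -
    have fin: "\<And>j. finite (kcells K j)" using F by blast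
    have eq: "(\<Sum>\<sigma> | \<sigma> \<in> cells K \<and> inc K \<tau> \<sigma> * inc K \<sigma> \<nu> \<noteq> 0. inc K \<tau> \<sigma> * inc K \<sigma> \<nu>)
        = (\<Sum>\<sigma>\<in>kcells K (Suc (cdim K \<nu>)). inc K \<tau> \<sigma> * inc K \<sigma> \<nu>)" if "\<nu> \<in> cells K" for \<tau> \<nu>
      using composition_sum_eq[of K \<nu> \<tau>] fin L1 that by blast
    have dd: "boundary K (Suc k) (boundary K (Suc (Suc k)) c) x =
        (\<Sum>\<tau>\<in>kcells K (Suc (Suc k)). c \<tau> * (\<Sum>\<sigma>\<in>kcells K (Suc k). inc K \<tau> \<sigma> * inc K \<sigma> x))"
      if "x \<in> kcells K k" for k c x
    proof -
      have "boundary K (Suc k) (boundary K (Suc (Suc k)) c) x =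
        (\<Sum>\<sigma>\<in>kcells K (Suc k). (\<Sum>\<tau>\<in>kcells K (Suc (Suc k)). c \<tau> * inc K \<tau> \<sigma>) * inc K \<sigma> x)"
        using that by (simp add: boundary_apply[OF fin] kcells_def)
      also have "\<dots> = (\<Sum>\<sigma>\<in>kcells K (Suc k). \<Sum>\<tau>\<in>kcells K (Suc (Suc k)). c \<tau> * (inc K \<tau> \<sigma> * inc K \<sigma> x))"
        by (simp add: sum_distrib_right mult.assoc)
      also have "\<dots> = (\<Sum>\<tau>\<in>kcells K (Suc (Suc k)). c \<tau> * (\<Sum>\<sigma>\<in>kcells K (Suc k). inc K \<tau> \<sigma> * inc K \<sigma> x))"
        by (subst sum.swap) (simp add: sum_distrib_left)
      finally show ?thesis .
    qed
    show ?thesis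
    proof
      assume L2: ?L2
      show ?D
      proof (intro allI ballI ext)
        fix k c x
        show "boundary K (Suc k) (boundary K (Suc (Suc k)) c) x = 0 x"
        proof (cases "x \<in> kcells K k")
          case True
          then have x: "x \<in> cells K" "cdim K x = k" by (auto simp: kcells_def)
          have "(\<Sum>\<sigma>\<in>kcells K (Suc k). inc K \<tau> \<sigma> * inc K \<sigma> x) = 0"
            if "\<tau> \<in> kcells K (Suc (Suc k))" for \<tau>
            using L2 eq[OF x(1), of \<tau>] x that by (simp add: kcells_def)
          then show ?thesis by (simp add: dd[OF True])
        next
          case False
          then show ?thesis by (auto simp: boundary_apply[OF fin] kcells_def)
        qed
      qed
    next
      assume D: ?D
      show ?L2
      proof (intro ballI)
        fix \<tau> \<nu> assume cells: "\<tau> \<in> cells K" "\<nu> \<in> cells K"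
        let ?k = "cdim K \<nu>"
        have "(\<Sum>\<sigma>\<in>kcells K (Suc ?k). inc K \<tau> \<sigma> * inc K \<sigma> \<nu>) = 0"
        proof (cases "cdim K \<tau> = Suc (Suc ?k)")
          case True
          then have \<tau>: "\<tau> \<in> kcells K (Suc (Suc ?k))" using cells by (simp add: kcells_def)
          then have "cell_chain \<tau> \<in> chains K (Suc (Suc ?k))"
            by (auto simp: chains_def intro: span_base)
          then have "0 = boundary K (Suc ?k) (boundary K (Suc (Suc ?k)) (cell_chain \<tau>)) \<nu>"
            using D by simp
          also have "\<dots> = (\<Sum>\<sigma>\<in>kcells K (Suc ?k). inc K \<tau> \<sigma> * inc K \<sigma> \<nu>)"
            using cells by (simp add: boundary_apply[OF fin, of "Suc ?k"]
                boundary_cell_chain[OF fin \<tau>]) (intro sum.cong, auto simp: kcells_def)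
          finally show ?thesis by simp
        next
          case False
          then have "inc K \<tau> \<sigma> = 0" if "\<sigma> \<in> kcells K (Suc ?k)" for \<sigma>
            using L1 cells that unfolding kcells_def by (metis (mono_tags, lifting) mem_Collect_eq)
          then show ?thesis by simp
        qed
        then show "(\<Sum>\<sigma> | \<sigma> \<in> cells K \<and> inc K \<tau> \<sigma> * inc K \<sigma> \<nu> \<noteq> 0. inc K \<tau> \<sigma> * inc K \<sigma> \<nu>) = 0"
          by (simp only: eq[OF cells(2)])
      qed
    qed
  qed
  with def show ?thesis by blast
qed

section \<open>Invariance under chain isomorphisms\<close>

lemma dim_injective_linear_image:
  assumes f: "linear f" "inj f"
  shows "dim (f ` S) = dim S"
proof -
  obtain B where B: "B \<subseteq> S" "independent B" "S \<subseteq> span B" "card B = dim S"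
    using basis_exists[of S] by blast
  have "span B = span S" using B by (meson span_eq span_superset subset_trans)
  then have "span (f ` B) = span (f ` S)" by (simp add: linear_span_image[OF f(1)])
  moreover have "independent (f ` B)"
    using linear_independent_injective_image[OF f(1) B(2)] f(2) by (simp add: inj_on_subset)
  ultimately have "dim (f ` S) = card (f ` B)" by (rule dim_eq_card)
  then show ?thesis using B(4) f(2) by (simp add: card_image inj_on_subset)
qed

text \<open>Both complexes have the same cells in every dimension, so \<open>\<phi>\<close> is a chain isomorphism from \<open>B\<close> to
  \<open>A\<close> given by one linear map on all functions. It carries cycles onto cycles and boundaries onto
  boundaries.\<close>

lemma chain_isomorphism_invariance:
  fixes \<phi> :: "('a \<Rightarrow> real) \<Rightarrow> 'a \<Rightarrow> real"
  assumes cells: "kcells B = kcells A"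
    and \<phi>: "linear \<phi>" "inj \<phi>"
    and chains: "\<And>k. \<phi> ` chains A k = chains A k"
    and comm: "\<And>k c. c \<in> chains A k \<Longrightarrow> \<phi> (boundary B k c) = boundary A k (\<phi> c)"
  shows "poincare_series B = poincare_series A"
    and "dim (boundaries B k) = dim (boundaries A k)"
proof -
  have chains_eq: "chains B = chains A" by (simp add: chains_def cells fun_eq_iff)
  have boundaries: "boundaries A k = \<phi> ` boundaries B k" for k
  proof -
    have "boundaries A k = boundary A (Suc k) ` \<phi> ` chains A (Suc k)"
      by (simp add: boundaries_def chains)
    then show ?thesis by (simp add: boundaries_def chains_eq image_image comm)
  qed
  have cycles: "cycles A k = \<phi> ` cycles B k" for k
  proof -
    have "boundary A k (\<phi> c) = 0 \<longleftrightarrow> boundary B k c = 0" if "c \<in> chains A k" for c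
      using comm[OF that] linear_0[OF \<phi>(1)] \<phi>(2) by (metis injD)
    then have "{c \<in> \<phi> ` chains A k. boundary A k c = 0} = \<phi> ` {c \<in> chains A k. boundary B k c = 0}"
      by auto
    then show ?thesis by (simp add: cycles_def chains chains_eq)
  qed
  show "poincare_series B = poincare_series A"
    using module_rank_quotient_image[OF \<phi> subspace_cycles subspace_boundaries]
    by (simp add: poincare_series_def homology_def cycles boundaries)
  show "dim (boundaries B k) = dim (boundaries A k)"
    by (simp add: boundaries dim_injective_linear_image[OF \<phi>])
qed

section \<open>The change of basis that splits off a pair\<close>

text \<open>The complex \<open>K\<^sub>E\<close>.\<close>

abbreviation split_pair :: "'a complex_data \<Rightarrow> 'a \<Rightarrow> 'a \<Rightarrow> 'a complex_data" where
  "split_pair K \<mu> \<kappa> \<equiv> disjoint_union (cancel_pair K \<mu> \<kappa>) (elementary_block K \<mu> \<kappa>)"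

text \<open>This construction covers both complexes of interest: a constant \<open>h\<close> and all cells give \<open>K\<close>
  itself, while \<open>h = f\<close> and the weakly critical cells give the weakly critical complex.\<close>

definition level_complex :: "'a complex_data \<Rightarrow> 'a set \<Rightarrow> ('a \<Rightarrow> real) \<Rightarrow> 'a complex_data" where
  "level_complex K C h =
     \<lparr>cells = C, cdim = cdim K, inc = (\<lambda>\<tau> \<sigma>. if h \<tau> = h \<sigma> then inc K \<tau> \<sigma> else 0)\<rparr>"

lemma level_complex_simps [simp]:
  "cells (level_complex K C h) = C"
  "cdim (level_complex K C h) = cdim K"
  "inc (level_complex K C h) \<tau> \<sigma> = (if h \<tau> = h \<sigma> then inc K \<tau> \<sigma> else 0)"
  by (simp_all add: level_complex_def)

locale incident_pair =
  fixes K :: "'a complex_data" and \<mu> \<kappa> :: 'a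
  assumes lefschetz: "lefschetz_complex K"
    and \<mu>_cell: "\<mu> \<in> cells K" and \<kappa>_cell: "\<kappa> \<in> cells K"
    and incident: "inc K \<mu> \<kappa> \<noteq> 0"
begin

lemma finite_kcells: "finite (kcells K k)"
  using lefschetz by (simp add: lefschetz_complex_def)

lemma inc_dim: "inc K \<tau> \<sigma> \<noteq> 0 \<Longrightarrow> \<tau> \<in> cells K \<Longrightarrow> \<sigma> \<in> cells K \<Longrightarrow> cdim K \<tau> = Suc (cdim K \<sigma>)"
  using lefschetz unfolding lefschetz_complex_iff_boundary_boundary by blast

lemma dim_\<mu>: "cdim K \<mu> = Suc (cdim K \<kappa>)"
  using inc_dim incident \<mu>_cell \<kappa>_cell by blast

lemma \<kappa>_neq_\<mu> [simp]: "\<kappa> \<noteq> \<mu>" "\<mu> \<noteq> \<kappa>"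
  using dim_\<mu> by auto

lemma inc_composition:
  assumes "\<tau> \<in> cells K" "\<nu> \<in> cells K"
  shows "(\<Sum>\<sigma>\<in>kcells K (Suc (cdim K \<nu>)). inc K \<tau> \<sigma> * inc K \<sigma> \<nu>) = 0"
  using lefschetz assms composition_sum_eq[OF finite_kcells inc_dim assms(2), of \<tau>]
  by (simp add: lefschetz_complex_def)

lemma split_pair_simps [simp]:
  "cells (split_pair K \<mu> \<kappa>) = cells K"
  "cdim (split_pair K \<mu> \<kappa>) = cdim K"
  using \<mu>_cell \<kappa>_cell
  by (auto simp: disjoint_union_def cancel_pair_def elementary_block_def)

lemma inc_split_pair:
  assumes "\<tau> \<in> cells K" "\<sigma> \<in> cells K"
  shows "inc (split_pair K \<mu> \<kappa>) \<tau> \<sigma> =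
    (if \<tau> = \<mu> \<and> \<sigma> = \<kappa> then 1
     else if \<tau> \<in> {\<mu>, \<kappa>} \<or> \<sigma> \<in> {\<mu>, \<kappa>} then 0
     else inc K \<tau> \<sigma> - inc K \<tau> \<kappa> * inc K \<mu> \<sigma> / inc K \<mu> \<kappa>)"
  using assms by (auto simp: disjoint_union_def cancel_pair_def elementary_block_def)

text \<open>The multiple of \<open>\<mu>\<close> that has to be subtracted from \<open>\<tau>\<close> to eliminate \<open>\<kappa>\<close> from its boundary. The
  cell \<open>\<mu>\<close> is kept as a basis vector, whence the value \<open>0\<close> there.\<close>

definition elim_coeff :: "'a \<Rightarrow> real" where
  "elim_coeff \<tau> = (if \<tau> \<in> cells K \<and> \<tau> \<noteq> \<mu> then inc K \<tau> \<kappa> / inc K \<mu> \<kappa> else 0)"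

definition boundary_\<mu> :: "'a \<Rightarrow> real" where
  "boundary_\<mu> \<sigma> = (if \<sigma> \<in> cells K then inc K \<mu> \<sigma> else 0)"

text \<open>The linear map with \<open>\<tau> \<mapsto> \<tau> - elim_coeff \<tau> * \<mu>\<close> for \<open>\<tau> \<noteq> \<kappa>\<close> and \<open>\<kappa> \<mapsto> \<partial>\<mu>\<close>.\<close>

definition basis_change :: "('a \<Rightarrow> real) \<Rightarrow> 'a \<Rightarrow> real" where
  "basis_change c = c
     - (\<Sum>\<tau>\<in>kcells K (cdim K \<mu>). elim_coeff \<tau> * c \<tau>) *\<^sub>R cell_chain \<mu>
     + c \<kappa> *\<^sub>R (boundary_\<mu> - cell_chain \<kappa>)"

text \<open>Solve first for the coefficient at \<open>\<kappa>\<close>, which \<open>basis_change\<close> multiplies by \<open>w(\<mu>,\<kappa>)\<close>, then for the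
  other coefficients, and for the one at \<open>\<mu>\<close> last.\<close>

definition basis_change_inv :: "('a \<Rightarrow> real) \<Rightarrow> 'a \<Rightarrow> real" where
  "basis_change_inv d =
     (let c = d - (d \<kappa> / inc K \<mu> \<kappa>) *\<^sub>R (boundary_\<mu> - cell_chain \<kappa>)
      in c + (\<Sum>\<tau>\<in>kcells K (cdim K \<mu>). elim_coeff \<tau> * c \<tau>) *\<^sub>R cell_chain \<mu>)"

lemma elim_coeff_\<mu> [simp]: "elim_coeff \<mu> = 0"
  by (simp add: elim_coeff_def)

lemma elim_coeff_nonzero:
  assumes "elim_coeff \<tau> \<noteq> 0"
  shows "\<tau> \<in> kcells K (cdim K \<mu>)" "\<tau> \<noteq> \<mu>" "inc K \<tau> \<kappa> \<noteq> 0"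
  using assms inc_dim[of \<tau> \<kappa>] \<kappa>_cell dim_\<mu>
  by (auto simp: elim_coeff_def kcells_def split: if_splits)

lemma elim_coeff_\<kappa> [simp]: "elim_coeff \<kappa> = 0"
  using elim_coeff_nonzero(1)[of \<kappa>] dim_\<mu> by (auto simp: kcells_def)

lemma boundary_\<mu>_nonzero:
  assumes "boundary_\<mu> \<sigma> \<noteq> 0"
  shows "\<sigma> \<in> kcells K (cdim K \<kappa>)" "inc K \<mu> \<sigma> \<noteq> 0"
  using assms inc_dim[of \<mu> \<sigma>] \<mu>_cell dim_\<mu>
  by (auto simp: boundary_\<mu>_def kcells_def split: if_splits)

lemma boundary_\<mu>_\<kappa> [simp]: "boundary_\<mu> \<kappa> = inc K \<mu> \<kappa>"
  using \<kappa>_cell by (simp add: boundary_\<mu>_def)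

lemma boundary_\<mu>_\<mu> [simp]: "boundary_\<mu> \<mu> = 0"
  using boundary_\<mu>_nonzero(1)[of \<mu>] dim_\<mu> by (auto simp: kcells_def)

lemma basis_change_apply:
  "basis_change c x = c x
     - (if x = \<mu> then \<Sum>\<tau>\<in>kcells K (cdim K \<mu>). elim_coeff \<tau> * c \<tau> else 0)
     + c \<kappa> * (boundary_\<mu> x - cell_chain \<kappa> x)"
  by (simp add: basis_change_def scaleR_fun_def cell_chain_apply)

lemma linear_basis_change: "linear basis_change"
proof (rule linearI)
  fix b c :: "'a \<Rightarrow> real" and r :: real
  show "basis_change (b + c) = basis_change b + basis_change c"
    by (rule ext) (simp add: basis_change_apply distrib_left sum.distrib algebra_simps)
  show "basis_change (r *\<^sub>R c) = r *\<^sub>R basis_change c"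
    by (rule ext)
      (simp add: basis_change_apply scaleR_fun_def algebra_simps sum_distrib_left)
qed

lemma inj_basis_change: "inj basis_change"
proof -
  have "c = 0" if c: "basis_change c = 0" for c
  proof -
    have "basis_change c \<kappa> = 0" by (simp add: c)
    then have "c \<kappa> * inc K \<mu> \<kappa> = 0"
      by (simp add: basis_change_apply cell_chain_apply algebra_simps)
    then have \<kappa>: "c \<kappa> = 0" using incident by simp
    have off: "c x = 0" if "x \<noteq> \<mu>" for x
      using fun_cong[OF c, of x] that \<kappa> by (simp add: basis_change_apply)
    have "(\<Sum>\<tau>\<in>kcells K (cdim K \<mu>). elim_coeff \<tau> * c \<tau>) = 0"
      by (intro sum.neutral ballI) (metis elim_coeff_\<mu> mult_eq_0_iff off)
    then have "c \<mu> = 0" using fun_cong[OF c, of \<mu>] \<kappa> by (simp add: basis_change_apply)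
    then show ?thesis using off by (metis zero_fun_apply ext)
  qed
  then show ?thesis using linear_injective_0[OF linear_basis_change] by blast
qed

lemma basis_change_inverse: "basis_change (basis_change_inv d) = d"
proof -
  define c where "c = d - (d \<kappa> / inc K \<mu> \<kappa>) *\<^sub>R (boundary_\<mu> - cell_chain \<kappa>)"
  define S where "S = (\<Sum>\<tau>\<in>kcells K (cdim K \<mu>). elim_coeff \<tau> * c \<tau>)"
  have e: "basis_change_inv d = c + S *\<^sub>R cell_chain \<mu>"
    by (simp add: basis_change_inv_def c_def S_def Let_def)
  have c\<kappa>: "c \<kappa> = d \<kappa> / inc K \<mu> \<kappa>"
    using incident by (simp add: c_def scaleR_fun_def cell_chain_apply field_simps)
  have "(\<Sum>\<tau>\<in>kcells K (cdim K \<mu>). elim_coeff \<tau> * (c + S *\<^sub>R cell_chain \<mu>) \<tau>) = S"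
    unfolding S_def by (intro sum.cong) (auto simp: scaleR_fun_def cell_chain_apply)
  then show ?thesis
    unfolding e using c\<kappa> by (intro ext)
      (simp add: basis_change_apply cell_chain_apply scaleR_fun_def,
        simp add: c_def scaleR_fun_def cell_chain_apply)
qed

lemma basis_change_cell_chain:
  assumes "\<tau> \<noteq> \<kappa>"
  shows "basis_change (cell_chain \<tau>) = cell_chain \<tau> - elim_coeff \<tau> *\<^sub>R cell_chain \<mu>"
proof -
  have "(\<Sum>\<sigma>\<in>kcells K (cdim K \<mu>). elim_coeff \<sigma> * cell_chain \<tau> \<sigma>)
      = (\<Sum>\<sigma>\<in>kcells K (cdim K \<mu>). if \<sigma> = \<tau> then elim_coeff \<tau> else 0)"
    by (intro sum.cong) (auto simp: cell_chain_apply)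
  also have "\<dots> = elim_coeff \<tau>"
    using finite_kcells elim_coeff_nonzero(1)[of \<tau>] by (auto simp: sum.delta)
  finally show ?thesis
    using assms by (simp add: basis_change_def cell_chain_apply)
qed

lemma basis_change_cell_chain_\<kappa>: "basis_change (cell_chain \<kappa>) = boundary_\<mu>"
proof -
  have "(\<Sum>\<sigma>\<in>kcells K (cdim K \<mu>). elim_coeff \<sigma> * cell_chain \<kappa> \<sigma>) = 0"
    by (intro sum.neutral) (auto simp: cell_chain_apply)
  then show ?thesis by (simp add: basis_change_def cell_chain_apply)
qed

end

section \<open>Splitting off a pair is a chain isomorphism\<close>

text \<open>The conditions say that \<open>basis_change\<close> is supported on the cells in \<open>C\<close> and mixes only cells
  with the same value of \<open>h\<close>. This is what makes it compatible with discarding all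
  incidences between different values.\<close>

locale incident_pair_level = incident_pair +
  fixes C :: "'a set" and h :: "'a \<Rightarrow> real"
  assumes C_cells: "C \<subseteq> cells K"
    and C_coface: "\<And>\<tau>. \<tau> \<in> cells K \<Longrightarrow> inc K \<tau> \<kappa> \<noteq> 0 \<Longrightarrow> \<tau> \<in> C"
    and C_face: "\<And>\<sigma>. \<sigma> \<in> cells K \<Longrightarrow> inc K \<mu> \<sigma> \<noteq> 0 \<Longrightarrow> \<sigma> \<in> C"
    and h_\<mu>: "\<And>\<tau>. \<tau> \<in> C \<Longrightarrow> cdim K \<tau> = cdim K \<mu> \<Longrightarrow> h \<tau> = h \<mu>"
    and h_\<kappa>: "\<And>\<sigma>. \<sigma> \<in> C \<Longrightarrow> cdim K \<sigma> = cdim K \<kappa> \<Longrightarrow> h \<sigma> = h \<kappa>"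
begin

abbreviation "L \<equiv> level_complex K C h"
abbreviation "L\<^sub>E \<equiv> level_complex (split_pair K \<mu> \<kappa>) C h"

lemma \<mu>_C: "\<mu> \<in> C" and \<kappa>_C: "\<kappa> \<in> C"
  using C_coface C_face \<mu>_cell \<kappa>_cell incident by auto

lemma kcells_L: "kcells L k = {\<sigma> \<in> C. cdim K \<sigma> = k}" "kcells L\<^sub>E k = {\<sigma> \<in> C. cdim K \<sigma> = k}"
  by (auto simp: kcells_def)

lemma finite_kcells_L: "finite (kcells L k)" "finite (kcells L\<^sub>E k)"
proof -
  have "{\<sigma> \<in> C. cdim K \<sigma> = k} \<subseteq> kcells K k" using C_cells by (auto simp: kcells_def)
  then have "finite {\<sigma> \<in> C. cdim K \<sigma> = k}" using finite_kcells finite_subset by blast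
  then show "finite (kcells L k)" "finite (kcells L\<^sub>E k)" by (simp_all only: kcells_L)
qed

lemma chains_L_iff: "c \<in> chains L k \<longleftrightarrow> (\<forall>x. c x \<noteq> 0 \<longrightarrow> x \<in> C \<and> cdim K x = k)"
  using chains_iff[OF finite_kcells_L(1)] by (simp add: kcells_L)

lemma elim_sum_nonzero:
  assumes "(\<Sum>\<tau>\<in>kcells K (cdim K \<mu>). elim_coeff \<tau> * c \<tau>) \<noteq> 0"
  obtains \<tau> where "cdim K \<tau> = cdim K \<mu>" "c \<tau> \<noteq> 0"
  using sum.not_neutral_contains_not_neutral[OF assms] by (auto simp: kcells_def)

lemma boundary_\<mu>_chain: "boundary_\<mu> \<in> chains L (cdim K \<kappa>)"
  using boundary_\<mu>_nonzero C_face by (auto simp: chains_L_iff kcells_def)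

lemma cell_chain_L: "\<sigma> \<in> C \<Longrightarrow> cell_chain \<sigma> \<in> chains L (cdim K \<sigma>)"
  by (auto simp: chains_L_iff cell_chain_apply split: if_splits)

lemma elim_sum_chain:
  assumes "c \<in> chains L k"
  shows "(\<Sum>\<tau>\<in>kcells K (cdim K \<mu>). elim_coeff \<tau> * c \<tau>) *\<^sub>R cell_chain \<mu> \<in> chains L k"
proof (cases "(\<Sum>\<tau>\<in>kcells K (cdim K \<mu>). elim_coeff \<tau> * c \<tau>) = 0")
  case True
  then show ?thesis using subspace_0[OF subspace_chains] by simp
next
  case False
  then have "k = cdim K \<mu>" using assms by (auto simp: chains_L_iff elim: elim_sum_nonzero)
  then show ?thesis using cell_chain_L[OF \<mu>_C] by (auto intro: subspace_scale[OF subspace_chains])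
qed

lemma \<kappa>_term_chain:
  assumes "c \<in> chains L k"
  shows "(c \<kappa> / r) *\<^sub>R (boundary_\<mu> - cell_chain \<kappa>) \<in> chains L k"
proof (cases "c \<kappa> = 0")
  case True
  then show ?thesis using subspace_0[OF subspace_chains] by simp
next
  case False
  then have "k = cdim K \<kappa>" using assms by (auto simp: chains_L_iff)
  then show ?thesis
    using cell_chain_L[OF \<kappa>_C] boundary_\<mu>_chain
    by (auto intro: subspace_scale[OF subspace_chains] subspace_diff[OF subspace_chains])
qed

lemma basis_change_chains: "basis_change ` chains L k = chains L k"
proof (intro equalityI subsetI)
  fix d assume "d \<in> basis_change ` chains L k"
  then obtain c where c: "c \<in> chains L k" "d = basis_change c" by blast
  then show "d \<in> chains L k"
    using elim_sum_chain[OF c(1)] \<kappa>_term_chain[OF c(1), of 1]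
    by (auto simp: basis_change_def
        intro!: subspace_add[OF subspace_chains] subspace_diff[OF subspace_chains])
next
  fix d assume d: "d \<in> chains L k"
  have "d - (d \<kappa> / inc K \<mu> \<kappa>) *\<^sub>R (boundary_\<mu> - cell_chain \<kappa>) \<in> chains L k"
    using \<kappa>_term_chain[OF d] d by (auto intro: subspace_diff[OF subspace_chains])
  then have "basis_change_inv d \<in> chains L k"
    unfolding basis_change_inv_def Let_def
    by (intro subspace_add[OF subspace_chains] elim_sum_chain)
  then show "d \<in> basis_change ` chains L k"
    using basis_change_inverse[of d] by (metis imageI)
qed

text \<open>On \<open>\<mu>\<close>: the boundary in \<open>L\<^sub>E\<close> is \<open>\<kappa>\<close>, which is sent to \<open>\<partial>\<mu>\<close>. If \<open>h\<close> separates \<open>\<mu>\<close> from \<open>\<kappa>\<close>, it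
  separates \<open>\<mu>\<close> from all its faces, and both sides are zero.\<close>

lemma basis_change_boundary_\<mu>:
  "basis_change (boundary L\<^sub>E (cdim K \<mu>) (cell_chain \<mu>)) = boundary L (cdim K \<mu>) (basis_change (cell_chain \<mu>))"
proof -
  let ?r = "if h \<mu> = h \<kappa> then 1 else 0 :: real"
  have \<mu>: "\<mu> \<in> kcells L (cdim K \<mu>)" "\<mu> \<in> kcells L\<^sub>E (cdim K \<mu>)" using \<mu>_C by (auto simp: kcells_L)
  have "boundary L\<^sub>E (cdim K \<mu>) (cell_chain \<mu>) = ?r *\<^sub>R cell_chain \<kappa>"
  proof
    fix x
    have "inc (split_pair K \<mu> \<kappa>) \<mu> x = (if x = \<kappa> then 1 else 0)" if "x \<in> C"
      using that C_cells \<mu>_cell by (subst inc_split_pair) auto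
    then show "boundary L\<^sub>E (cdim K \<mu>) (cell_chain \<mu>) x = (?r *\<^sub>R cell_chain \<kappa>) x"
      unfolding boundary_cell_chain[OF finite_kcells_L(2) \<mu>(2)]
      using \<kappa>_C dim_\<mu> by (auto simp: scaleR_fun_def cell_chain_apply)
  qed
  then have "basis_change (boundary L\<^sub>E (cdim K \<mu>) (cell_chain \<mu>)) = ?r *\<^sub>R boundary_\<mu>"
    by (simp only: linear_scale[OF linear_basis_change] basis_change_cell_chain_\<kappa>)
  also have "\<dots> = boundary L (cdim K \<mu>) (cell_chain \<mu>)"
  proof
    fix x
    show "(?r *\<^sub>R boundary_\<mu>) x = boundary L (cdim K \<mu>) (cell_chain \<mu>) x"
    proof (cases "boundary_\<mu> x = 0")
      case True
      then have "inc K \<mu> x = 0" if "x \<in> C" using that C_cells by (auto simp: boundary_\<mu>_def)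
      then show ?thesis using True by (simp add: boundary_cell_chain[OF finite_kcells_L(1) \<mu>(1)] scaleR_fun_def)
    next
      case False
      then have "x \<in> C" "cdim K x = cdim K \<kappa>" using boundary_\<mu>_chain by (auto simp: chains_L_iff)
      then show ?thesis
        unfolding boundary_cell_chain[OF finite_kcells_L(1) \<mu>(1)]
        using h_\<kappa>[of x] dim_\<mu> C_cells by (auto simp: scaleR_fun_def boundary_\<mu>_def)
    qed
  qed
  finally show ?thesis by (simp add: basis_change_cell_chain)
qed

text \<open>On \<open>\<kappa>\<close>: its boundary in \<open>L\<^sub>E\<close> is zero, and in \<open>L\<close> one has \<open>\<partial>\<partial>\<mu> = 0\<close>. The latter holds although
  \<open>\<partial>\<mu>\<close> is formed in \<open>K\<close>: all faces of \<open>\<mu>\<close> lie in \<open>C\<close> and have the same value of \<open>h\<close>, so the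
  coefficient at a cell \<open>x\<close> is a constant multiple of the one in \<open>K\<close>.\<close>

lemma basis_change_boundary_\<kappa>:
  "basis_change (boundary L\<^sub>E (cdim K \<kappa>) (cell_chain \<kappa>)) = boundary L (cdim K \<kappa>) (basis_change (cell_chain \<kappa>))"
proof -
  have \<kappa>: "\<kappa> \<in> kcells L\<^sub>E (cdim K \<kappa>)" using \<kappa>_C by (auto simp: kcells_L)
  have "boundary L\<^sub>E (cdim K \<kappa>) (cell_chain \<kappa>) = 0"
  proof
    fix x
    have "inc (split_pair K \<mu> \<kappa>) \<kappa> x = 0" if "x \<in> C"
      using that C_cells \<kappa>_cell by (subst inc_split_pair) auto
    then show "boundary L\<^sub>E (cdim K \<kappa>) (cell_chain \<kappa>) x = 0 x"
      by (simp add: boundary_cell_chain[OF finite_kcells_L(2) \<kappa>])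
  qed
  moreover have "boundary L (cdim K \<kappa>) boundary_\<mu> = 0"
  proof
    fix x
    show "boundary L (cdim K \<kappa>) boundary_\<mu> x = 0 x"
    proof (cases "x \<in> C \<and> Suc (cdim K x) = cdim K \<kappa>")
      case True
      then have x: "x \<in> cells K" using C_cells by blast
      let ?r = "if h \<kappa> = h x then 1 else 0 :: real"
      have "(\<Sum>\<sigma>\<in>kcells L (cdim K \<kappa>). boundary_\<mu> \<sigma> * inc L \<sigma> x)
          = (\<Sum>\<sigma>\<in>kcells K (cdim K \<kappa>). ?r * (inc K \<mu> \<sigma> * inc K \<sigma> x))"
      proof (rule sum.mono_neutral_cong_left)
        show "\<forall>\<sigma>\<in>kcells K (cdim K \<kappa>) - kcells L (cdim K \<kappa>). ?r * (inc K \<mu> \<sigma> * inc K \<sigma> x) = 0"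
          using C_face by (auto simp: kcells_def)
        show "boundary_\<mu> \<sigma> * inc L \<sigma> x = ?r * (inc K \<mu> \<sigma> * inc K \<sigma> x)" if "\<sigma> \<in> kcells L (cdim K \<kappa>)" for \<sigma>
          using that h_\<kappa>[of \<sigma>] C_cells by (auto simp: kcells_L boundary_\<mu>_def)
      qed (use C_cells finite_kcells in \<open>auto simp: kcells_def\<close>)
      also have "\<dots> = 0"
        using inc_composition[OF \<mu>_cell x] True by (simp add: sum_distrib_left[symmetric])
      finally show ?thesis by (simp add: boundary_apply[OF finite_kcells_L(1)])
    next
      case False
      then show ?thesis by (auto simp: boundary_apply[OF finite_kcells_L(1)])
    qed
  qed
  ultimately show ?thesis
    by (simp add: basis_change_cell_chain_\<kappa> linear_0[OF linear_basis_change])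
qed

text \<open>On the remaining cells the coefficients at \<open>x \<noteq> \<mu>\<close> agree by the formula for the incidence numbers
  of a cancelled pair. The coefficient at \<open>\<mu>\<close> is an instance of \<open>\<partial>\<partial> = 0\<close>.\<close>

lemma basis_change_boundary_other:
  assumes \<tau>: "\<tau> \<in> C" "\<tau> \<noteq> \<mu>" "\<tau> \<noteq> \<kappa>"
  shows "basis_change (boundary L\<^sub>E (cdim K \<tau>) (cell_chain \<tau>))
    = boundary L (cdim K \<tau>) (basis_change (cell_chain \<tau>))"
proof
  fix x
  let ?k = "cdim K \<tau>"
  let ?b = "boundary L\<^sub>E ?k (cell_chain \<tau>)"
  have \<tau>K: "\<tau> \<in> cells K" using \<tau> C_cells by blast
  have \<tau>k: "\<tau> \<in> kcells L ?k" "\<tau> \<in> kcells L\<^sub>E ?k" using \<tau> by (auto simp: kcells_L)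
  have b: "?b y = (if y \<in> C \<and> Suc (cdim K y) = ?k \<and> h \<tau> = h y \<and> y \<noteq> \<mu> \<and> y \<noteq> \<kappa>
      then inc K \<tau> y - elim_coeff \<tau> * inc K \<mu> y else 0)" for y
    using \<tau> \<tau>K C_cells
    by (auto simp: boundary_cell_chain[OF finite_kcells_L(2) \<tau>k(2)] inc_split_pair elim_coeff_def)
  have "?b \<kappa> = 0" by (simp add: b)
  then have lhs: "basis_change ?b x
      = ?b x - (if x = \<mu> then \<Sum>\<sigma>\<in>kcells K (cdim K \<mu>). elim_coeff \<sigma> * ?b \<sigma> else 0)"
    by (simp add: basis_change_apply)
  have coeff: "?k = cdim K \<mu> \<and> h \<tau> = h \<mu>" if "elim_coeff \<tau> \<noteq> 0"
    using elim_coeff_nonzero(1)[OF that] h_\<mu> \<tau> by (auto simp: kcells_def)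
  have "boundary L ?k (basis_change (cell_chain \<tau>)) x
      = boundary L ?k (cell_chain \<tau>) x - elim_coeff \<tau> * boundary L ?k (cell_chain \<mu>) x"
    unfolding basis_change_cell_chain[OF \<tau>(3)] linear_diff[OF linear_boundary]
      linear_scale[OF linear_boundary] by (simp add: scaleR_fun_def)
  also have "\<dots> = (if x \<in> C \<and> Suc (cdim K x) = ?k \<and> h \<tau> = h x
      then inc K \<tau> x - elim_coeff \<tau> * inc K \<mu> x else 0)"
  proof (cases "elim_coeff \<tau> = 0")
    case True
    then show ?thesis by (simp add: boundary_cell_chain[OF finite_kcells_L(1) \<tau>k(1)])
  next
    case False
    then have \<mu>k: "\<mu> \<in> kcells L ?k" using coeff \<mu>_C by (simp add: kcells_L)
    show ?thesis
      unfolding boundary_cell_chain[OF finite_kcells_L(1) \<tau>k(1)]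
        boundary_cell_chain[OF finite_kcells_L(1) \<mu>k]
      using coeff[OF False] by simp
  qed
  finally have rhs: "boundary L ?k (basis_change (cell_chain \<tau>)) x
    = (if x \<in> C \<and> Suc (cdim K x) = ?k \<and> h \<tau> = h x
      then inc K \<tau> x - elim_coeff \<tau> * inc K \<mu> x else 0)" .
  consider "x = \<mu>" | "x = \<kappa>" | "x \<noteq> \<mu>" "x \<noteq> \<kappa>" by blast
  then show "basis_change ?b x = boundary L ?k (basis_change (cell_chain \<tau>)) x"
  proof cases
    case 1
    \<comment> \<open>The multiples of \<open>\<mu>\<close> contributed by the faces \<open>\<sigma> \<noteq> \<mu>\<close> of \<open>\<tau>\<close> must add up to \<open>w(\<tau>,\<mu>)\<close>. This is
      (L2) for \<open>\<tau>\<close> and \<open>\<kappa>\<close>, divided by \<open>w(\<mu>,\<kappa>)\<close> and with the summand of \<open>\<mu>\<close> set apart.\<close>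
    have \<mu>\<mu>: "inc K \<mu> \<mu> = 0" using inc_dim[of \<mu> \<mu>] \<mu>_cell by fastforce
    show ?thesis
    proof (cases "?k = Suc (cdim K \<mu>) \<and> h \<tau> = h \<mu>")
      case True
      then have "elim_coeff \<tau> = 0" using coeff by force
      have "elim_coeff \<sigma> * ?b \<sigma>
          = inc K \<tau> \<sigma> * inc K \<sigma> \<kappa> / inc K \<mu> \<kappa> - (if \<sigma> = \<mu> then inc K \<tau> \<mu> else 0)"
        if "\<sigma> \<in> kcells K (cdim K \<mu>)" for \<sigma>
      proof (cases "\<sigma> = \<mu> \<or> inc K \<sigma> \<kappa> = 0")
        case True
        then show ?thesis using incident by (auto simp: elim_coeff_def)
      next
        case False
        have \<sigma>: "\<sigma> \<in> cells K" "cdim K \<sigma> = cdim K \<mu>" using that by (auto simp: kcells_def)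
        then have "\<sigma> \<in> C" "h \<sigma> = h \<mu>" "\<sigma> \<noteq> \<kappa>" using False C_coface h_\<mu> dim_\<mu> by auto
        then have "?b \<sigma> = inc K \<tau> \<sigma>"
          using \<open>elim_coeff \<tau> = 0\<close> \<open>?k = Suc (cdim K \<mu>) \<and> h \<tau> = h \<mu>\<close> \<sigma> False
          unfolding b by simp
        then show ?thesis using False \<sigma> by (simp add: elim_coeff_def)
      qed
      then have "(\<Sum>\<sigma>\<in>kcells K (cdim K \<mu>). elim_coeff \<sigma> * ?b \<sigma>)
          = (\<Sum>\<sigma>\<in>kcells K (cdim K \<mu>). inc K \<tau> \<sigma> * inc K \<sigma> \<kappa>) / inc K \<mu> \<kappa> - inc K \<tau> \<mu>"
        using finite_kcells \<mu>_cell
        by (simp add: sum_subtractf sum_divide_distrib sum.delta kcells_def)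
      also have "\<dots> = - inc K \<tau> \<mu>"
        using inc_composition[OF \<tau>K \<kappa>_cell] dim_\<mu> by simp
      finally have elim: "(\<Sum>\<sigma>\<in>kcells K (cdim K \<mu>). elim_coeff \<sigma> * ?b \<sigma>) = - inc K \<tau> \<mu>" .
      show ?thesis
        unfolding lhs rhs unfolding 1 elim unfolding b using True \<mu>_C \<mu>\<mu> by simp
    next
      case False
      then have "elim_coeff \<sigma> * ?b \<sigma> = 0" if "\<sigma> \<in> kcells K (cdim K \<mu>)" for \<sigma>
        unfolding b using that h_\<mu>[of \<sigma>] by (auto simp: kcells_def)
      then have elim: "(\<Sum>\<sigma>\<in>kcells K (cdim K \<mu>). elim_coeff \<sigma> * ?b \<sigma>) = 0"
        by (intro sum.neutral ballI)
      show ?thesis unfolding lhs rhs unfolding 1 elim unfolding b using False by auto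
    qed
  next
    case 2
    then show ?thesis using \<tau> \<tau>K incident unfolding lhs rhs b by (simp add: elim_coeff_def)
  next
    case 3
    then show ?thesis unfolding lhs rhs b by simp
  qed
qed

lemma basis_change_boundary:
  assumes "c \<in> chains L k"
  shows "basis_change (boundary L\<^sub>E k c) = boundary L k (basis_change c)"
proof -
  have "(basis_change \<circ> boundary L\<^sub>E k) c = (boundary L k \<circ> basis_change) c"
  proof (rule linear_eq_on[where x = c and B = "cell_chain ` kcells L k"])
    show "c \<in> span (cell_chain ` kcells L k)" using assms by (simp add: chains_def)
    fix b assume "b \<in> cell_chain ` kcells L k"
    then obtain \<tau> where \<tau>: "\<tau> \<in> C" "k = cdim K \<tau>" "b = cell_chain \<tau>" by (auto simp: kcells_L)
    consider "\<tau> = \<mu>" | "\<tau> = \<kappa>" | "\<tau> \<noteq> \<mu>" "\<tau> \<noteq> \<kappa>" by blast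
    then have "basis_change (boundary L\<^sub>E k b) = boundary L k (basis_change b)"
    proof cases
      case 1
      then show ?thesis unfolding \<tau>(2,3) by (simp only: basis_change_boundary_\<mu>)
    next
      case 2
      then show ?thesis unfolding \<tau>(2,3) by (simp only: basis_change_boundary_\<kappa>)
    next
      case 3
      then show ?thesis unfolding \<tau>(2,3) by (rule basis_change_boundary_other[OF \<tau>(1)])
    qed
    then show "(basis_change \<circ> boundary L\<^sub>E k) b = (boundary L k \<circ> basis_change) b"
      by (simp only: comp_apply)
  qed (intro linear_compose linear_basis_change linear_boundary)+
  then show ?thesis by (simp only: comp_apply)
qed

lemma poincare_series_level: "poincare_series L\<^sub>E = poincare_series L"
  and dim_boundaries_level: "dim (boundaries L\<^sub>E k) = dim (boundaries L k)"
proof -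
  have "kcells L\<^sub>E = kcells L" by (simp add: fun_eq_iff kcells_L)
  note * = this linear_basis_change inj_basis_change basis_change_chains basis_change_boundary
  show "poincare_series L\<^sub>E = poincare_series L" by (rule chain_isomorphism_invariance(1)[OF *])
  show "dim (boundaries L\<^sub>E k) = dim (boundaries L k)" by (rule chain_isomorphism_invariance(2)[OF *])
qed

end

context incident_pair
begin

sublocale whole: incident_pair_level K \<mu> \<kappa> "cells K" "\<lambda>_. 0"
  by unfold_locales auto

lemma level_complex_whole:
  "level_complex K (cells K) (\<lambda>_. 0) = K"
  "level_complex (split_pair K \<mu> \<kappa>) (cells K) (\<lambda>_. 0) = split_pair K \<mu> \<kappa>"
  by (simp_all add: level_complex_def)

text \<open>(L2) for the new complex is conjugate, under the change of basis, to (L2) for \<open>K\<close>.\<close>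

lemma lefschetz_split_pair: "lefschetz_complex (split_pair K \<mu> \<kappa>)"
proof -
  let ?E = "split_pair K \<mu> \<kappa>"
  have kcells: "kcells ?E k = kcells K k" for k by (simp add: kcells_def)
  have L1: "cdim K \<tau> = Suc (cdim K \<sigma>)"
    if "\<tau> \<in> cells K" "\<sigma> \<in> cells K" "inc ?E \<tau> \<sigma> \<noteq> 0" for \<tau> \<sigma>
  proof -
    have "\<tau> = \<mu> \<and> \<sigma> = \<kappa> \<or> inc K \<tau> \<sigma> \<noteq> 0 \<or> inc K \<tau> \<kappa> \<noteq> 0 \<and> inc K \<mu> \<sigma> \<noteq> 0"
      using that(3) unfolding inc_split_pair[OF that(1,2)] by (auto split: if_splits)
    then consider "\<tau> = \<mu>" "\<sigma> = \<kappa>" | "inc K \<tau> \<sigma> \<noteq> 0" | "inc K \<tau> \<kappa> \<noteq> 0" "inc K \<mu> \<sigma> \<noteq> 0"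
      by blast
    then show ?thesis
    proof cases
      case 1
      then show ?thesis using dim_\<mu> by simp
    next
      case 2
      then show ?thesis using inc_dim that by blast
    next
      case 3
      then have "cdim K \<tau> = Suc (cdim K \<kappa>)" "cdim K \<mu> = Suc (cdim K \<sigma>)"
        using inc_dim that \<mu>_cell \<kappa>_cell by blast+
      then show ?thesis using dim_\<mu> by simp
    qed
  qed
  have L2: "boundary ?E (Suc k) (boundary ?E (Suc (Suc k)) c) = 0"
    if c: "c \<in> chains ?E (Suc (Suc k))" for k c
  proof -
    have c': "c \<in> chains K (Suc (Suc k))" using c by (simp add: chains_def kcells)
    have "boundary ?E (Suc (Suc k)) c \<in> chains ?E (Suc k)"
      by (intro boundary_in_chains) (simp add: kcells finite_kcells)
    then have b: "boundary ?E (Suc (Suc k)) c \<in> chains K (Suc k)"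
      by (simp add: chains_def kcells)
    have "basis_change (boundary ?E (Suc k) (boundary ?E (Suc (Suc k)) c))
        = boundary K (Suc k) (boundary K (Suc (Suc k)) (basis_change c))"
      using whole.basis_change_boundary[of _ "Suc k"] whole.basis_change_boundary[of _ "Suc (Suc k)"] b c'
      unfolding level_complex_whole by (simp only:)
    also have "\<dots> = 0"
    proof -
      have "basis_change c \<in> chains K (Suc (Suc k))"
        using whole.basis_change_chains c' unfolding level_complex_whole by (metis imageI)
      then show ?thesis
        using lefschetz unfolding lefschetz_complex_iff_boundary_boundary by (simp only: simp_thms)
    qed
    also have "\<dots> = basis_change 0"
      by (rule linear_0[OF linear_basis_change, symmetric])
    finally show ?thesis by (rule injD[OF inj_basis_change])
  qed
  show ?thesis
    unfolding lefschetz_complex_iff_boundary_boundary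
    using L1 L2 by (simp add: kcells finite_kcells)
qed

end

section \<open>The Morse-Bott condition\<close>

lemma (in incident_pair) second_path:
  assumes cells: "\<tau> \<in> cells K" "\<sigma> \<in> cells K" "\<nu> \<in> cells K"
    and path: "inc K \<tau> \<sigma> \<noteq> 0" "inc K \<sigma> \<nu> \<noteq> 0"
  obtains \<sigma>' where "\<sigma>' \<in> cells K" "\<sigma>' \<noteq> \<sigma>" "inc K \<tau> \<sigma>' \<noteq> 0" "inc K \<sigma>' \<nu> \<noteq> 0"
proof -
  let ?S = "kcells K (Suc (cdim K \<nu>))"
  have "\<sigma> \<in> ?S" using cells inc_dim path by (simp add: kcells_def)
  then have "inc K \<tau> \<sigma> * inc K \<sigma> \<nu> + (\<Sum>\<rho>\<in>?S - {\<sigma>}. inc K \<tau> \<rho> * inc K \<rho> \<nu>) = 0"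
    using inc_composition[OF cells(1,3)] by (simp add: sum.remove[OF finite_kcells])
  then have "(\<Sum>\<rho>\<in>?S - {\<sigma>}. inc K \<tau> \<rho> * inc K \<rho> \<nu>) \<noteq> 0" using path by auto
  then obtain \<rho> where "\<rho> \<in> ?S - {\<sigma>}" "inc K \<tau> \<rho> * inc K \<rho> \<nu> \<noteq> 0"
    by (rule sum.not_neutral_contains_not_neutral)
  then show thesis using that by (auto simp: kcells_def)
qed

locale morse_bott_pair = incident_pair +
  fixes f :: "'a \<Rightarrow> real"
  assumes morse_bott: "discrete_morse_bott K f"
    and f_dim: "\<And>\<sigma>. \<sigma> \<in> cells K \<Longrightarrow> cdim K \<sigma> = cdim K \<mu> \<or> cdim K \<sigma> = cdim K \<kappa> \<Longrightarrow> f \<sigma> = real (cdim K \<sigma>)"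
begin

lemma finite_cofaces: "\<sigma> \<in> cells K \<Longrightarrow> finite {\<tau> \<in> cells K. inc K \<tau> \<sigma> \<noteq> 0 \<and> P \<tau>}"
  by (rule finite_subset[OF _ finite_kcells[of "Suc (cdim K \<sigma>)"]])
    (auto simp: kcells_def dest: inc_dim)

lemma finite_faces: "\<sigma> \<in> cells K \<Longrightarrow> finite {\<nu> \<in> cells K. inc K \<sigma> \<nu> \<noteq> 0 \<and> P \<nu>}"
  by (rule finite_subset[OF _ finite_kcells[of "cdim K \<sigma> - 1"]]) (auto simp: kcells_def dest: inc_dim)

lemma unique_lower_coface:
  assumes "\<sigma> \<in> cells K" "\<tau> \<in> cells K" "inc K \<tau> \<sigma> \<noteq> 0" "f \<tau> < f \<sigma>"
    "\<tau>' \<in> cells K" "inc K \<tau>' \<sigma> \<noteq> 0" "f \<tau>' < f \<sigma>"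
  shows "\<tau>' = \<tau>"
proof -
  have "U_snc K f \<sigma> \<le> Suc 0" using morse_bott assms(1) by (simp add: discrete_morse_bott_def)
  then show ?thesis
    unfolding U_snc_def card_le_Suc0_iff_eq[OF finite_cofaces[OF assms(1)]] using assms(2-) by simp
qed

lemma unique_upper_face:
  assumes "\<sigma> \<in> cells K" "\<nu> \<in> cells K" "inc K \<sigma> \<nu> \<noteq> 0" "f \<sigma> < f \<nu>"
    "\<nu>' \<in> cells K" "inc K \<sigma> \<nu>' \<noteq> 0" "f \<sigma> < f \<nu>'"
  shows "\<nu>' = \<nu>"
proof -
  have "D_snc K f \<sigma> \<le> Suc 0" using morse_bott assms(1) by (simp add: discrete_morse_bott_def)
  then show ?thesis
    unfolding D_snc_def card_le_Suc0_iff_eq[OF finite_faces[OF assms(1)]] using assms(2-) by simp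
qed

text \<open>Otherwise \<open>\<nu>\<close> would have two cofaces of smaller value: \<open>\<sigma>\<close>, and the middle cell of a second path
  from \<open>\<mu>\<close> to \<open>\<nu>\<close>, on which \<open>f\<close> takes the same value as on \<open>\<sigma>\<close>.\<close>

lemma no_ascent_from_face:
  assumes "\<sigma> \<in> cells K" "inc K \<mu> \<sigma> \<noteq> 0" "\<nu> \<in> cells K" "inc K \<sigma> \<nu> \<noteq> 0"
  shows "f \<nu> \<le> f \<sigma>"
proof (rule ccontr)
  assume less: "\<not> f \<nu> \<le> f \<sigma>"
  obtain \<sigma>' where \<sigma>': "\<sigma>' \<in> cells K" "\<sigma>' \<noteq> \<sigma>" "inc K \<mu> \<sigma>' \<noteq> 0" "inc K \<sigma>' \<nu> \<noteq> 0"
    using second_path[OF \<mu>_cell assms(1,3,2,4)] .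
  have "cdim K \<sigma> = cdim K \<kappa>" "cdim K \<sigma>' = cdim K \<kappa>"
    using inc_dim[OF assms(2) \<mu>_cell assms(1)] inc_dim[OF \<sigma>'(3) \<mu>_cell \<sigma>'(1)] dim_\<mu> by linarith+
  then have "f \<sigma>' = f \<sigma>" using f_dim[OF assms(1)] f_dim[OF \<sigma>'(1)] by linarith
  then show False using unique_lower_coface[of \<nu> \<sigma> \<sigma>'] assms \<sigma>' less by auto
qed

text \<open>The dual statement, with \<open>D(\<rho>) \<le> 1\<close> in place of \<open>U(\<nu>) \<le> 1\<close>.\<close>

lemma no_ascent_to_coface:
  assumes "\<tau> \<in> cells K" "inc K \<tau> \<kappa> \<noteq> 0" "\<rho> \<in> cells K" "inc K \<rho> \<tau> \<noteq> 0"
  shows "f \<tau> \<le> f \<rho>"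
proof (rule ccontr)
  assume less: "\<not> f \<tau> \<le> f \<rho>"
  obtain \<tau>' where \<tau>': "\<tau>' \<in> cells K" "\<tau>' \<noteq> \<tau>" "inc K \<rho> \<tau>' \<noteq> 0" "inc K \<tau>' \<kappa> \<noteq> 0"
    using second_path[OF assms(3,1) \<kappa>_cell assms(4,2)] .
  have "cdim K \<tau> = cdim K \<mu>" "cdim K \<tau>' = cdim K \<mu>"
    using inc_dim[OF assms(2,1) \<kappa>_cell] inc_dim[OF \<tau>'(4,1) \<kappa>_cell] dim_\<mu> by linarith+
  then have "f \<tau>' = f \<tau>" using f_dim[OF assms(1)] f_dim[OF \<tau>'(1)] by linarith
  then show False using unique_upper_face[of \<rho> \<tau> \<tau>'] assms \<tau>' less by auto
qed

text \<open>The elimination changes incidence numbers only between the dimensions of \<open>\<mu>\<close> and \<open>\<kappa>\<close>, where \<open>f\<close>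
  decreases from a cell to its faces. Splitting off the pair also deletes the faces of \<open>\<kappa>\<close> and the
  cofaces of \<open>\<mu>\<close>, but none of these incidences is an ascent.\<close>

lemma inc_split_pair_ascent:
  assumes \<tau>: "\<tau> \<in> cells K" and \<sigma>: "\<sigma> \<in> cells K" and less: "f \<tau> < f \<sigma>"
  shows "inc (split_pair K \<mu> \<kappa>) \<tau> \<sigma> = inc K \<tau> \<sigma>"
proof -
  have drop: "f \<sigma>' < f \<tau>'" if "\<tau>' \<in> cells K" "\<sigma>' \<in> cells K" "cdim K \<tau>' = cdim K \<mu>" "cdim K \<sigma>' = cdim K \<kappa>" for \<tau>' \<sigma>'
    using f_dim[OF that(1)] f_dim[OF that(2)] that dim_\<mu> by simp
  have face: "cdim K \<sigma>' = cdim K \<kappa>" if "inc K \<mu> \<sigma>' \<noteq> 0" "\<sigma>' \<in> cells K" for \<sigma>'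
    using inc_dim[OF that(1) \<mu>_cell that(2)] dim_\<mu> by simp
  have coface: "cdim K \<tau>' = cdim K \<mu>" if "inc K \<tau>' \<kappa> \<noteq> 0" "\<tau>' \<in> cells K" for \<tau>'
    using inc_dim[OF that \<kappa>_cell] dim_\<mu> by simp
  have \<mu>\<sigma>: "inc K \<mu> \<sigma> = 0 \<or> inc K \<tau> \<kappa> = 0"
    using drop[OF \<tau> \<sigma> coface[OF _ \<tau>] face[OF _ \<sigma>]] less by linarith
  have 1: "inc K \<kappa> \<sigma> = 0" if "\<tau> = \<kappa>"
    using no_ascent_from_face[OF \<kappa>_cell incident \<sigma>] less unfolding that by linarith
  have 2: "inc K \<tau> \<mu> = 0" if "\<sigma> = \<mu>"
    using no_ascent_to_coface[OF \<mu>_cell incident \<tau>] less unfolding that by linarith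
  have 3: "inc K \<mu> \<sigma> = 0" if "\<tau> = \<mu>"
    using drop[OF \<mu>_cell \<sigma> refl face[OF _ \<sigma>]] less unfolding that by linarith
  have 4: "inc K \<tau> \<kappa> = 0" if "\<sigma> = \<kappa>"
    using drop[OF \<tau> \<kappa>_cell coface[OF _ \<tau>] refl] less unfolding that by linarith
  show ?thesis
    using \<mu>\<sigma> 1 2 3 4 incident \<tau> \<sigma> by (auto simp: inc_split_pair)
qed

lemma snc_split_pair:
  assumes "\<sigma> \<in> cells K"
  shows "U_snc (split_pair K \<mu> \<kappa>) f \<sigma> = U_snc K f \<sigma>" "D_snc (split_pair K \<mu> \<kappa>) f \<sigma> = D_snc K f \<sigma>"
  unfolding U_snc_def D_snc_def
  using assms inc_split_pair_ascent by (auto intro!: arg_cong[where f = card])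

lemma weakly_critical_iff:
  assumes "\<sigma> \<in> cells K"
  shows "weakly_critical K f \<sigma> \<longleftrightarrow>
    (\<forall>\<tau>\<in>cells K. inc K \<tau> \<sigma> \<noteq> 0 \<longrightarrow> f \<sigma> \<le> f \<tau>) \<and> (\<forall>\<nu>\<in>cells K. inc K \<sigma> \<nu> \<noteq> 0 \<longrightarrow> f \<nu> \<le> f \<sigma>)"
  using finite_cofaces[OF assms] finite_faces[OF assms]
  by (auto simp: weakly_critical_def U_snc_def D_snc_def not_less)

text \<open>A coface of \<open>\<kappa>\<close> has no coface of smaller value by \<open>no_ascent_to_coface\<close>, and no face of larger value
  because \<open>f\<close> is the dimension on it and on its faces; dually for the faces of \<open>\<mu>\<close>.\<close>

sublocale critical: incident_pair_level K \<mu> \<kappa> "{\<sigma> \<in> cells K. weakly_critical K f \<sigma>}" f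
proof unfold_locales
  fix \<tau> assume \<tau>: "\<tau> \<in> cells K" "inc K \<tau> \<kappa> \<noteq> 0"
  have "cdim K \<tau> = cdim K \<mu>" using \<tau> inc_dim \<kappa>_cell dim_\<mu> by simp
  then have "f \<nu> \<le> f \<tau>" if "\<nu> \<in> cells K" "inc K \<tau> \<nu> \<noteq> 0" for \<nu>
    using that \<tau> inc_dim[of \<tau> \<nu>] f_dim[of \<tau>] f_dim[of \<nu>] dim_\<mu> by simp
  then show "\<tau> \<in> {\<sigma> \<in> cells K. weakly_critical K f \<sigma>}"
    using \<tau> no_ascent_to_coface[OF \<tau>] by (simp add: weakly_critical_iff)
next
  fix \<sigma> assume \<sigma>: "\<sigma> \<in> cells K" "inc K \<mu> \<sigma> \<noteq> 0"
  have "cdim K \<sigma> = cdim K \<kappa>" using \<sigma> inc_dim[of \<mu> \<sigma>] \<mu>_cell dim_\<mu> by simp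
  then have "f \<sigma> \<le> f \<tau>" if "\<tau> \<in> cells K" "inc K \<tau> \<sigma> \<noteq> 0" for \<tau>
    using that \<sigma> inc_dim[of \<tau> \<sigma>] f_dim[of \<tau>] f_dim[of \<sigma>] dim_\<mu> by simp
  then show "\<sigma> \<in> {\<sigma> \<in> cells K. weakly_critical K f \<sigma>}"
    using \<sigma> no_ascent_from_face[OF \<sigma>] by (simp add: weakly_critical_iff)
qed (use f_dim \<mu>_cell \<kappa>_cell in auto)

lemma weakly_critical_complex_level:
  "weakly_critical_complex K f = critical.L"
  "weakly_critical_complex (split_pair K \<mu> \<kappa>) f = critical.L\<^sub>E"
  by (auto simp: weakly_critical_complex_def level_complex_def weakly_critical_def snc_split_pair)

end

theorem proposition5p14:
  fixes K K\<^sub>E :: "'a complex_data" and f :: "'a \<Rightarrow> real" and \<mu> \<kappa> :: 'a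
  assumes "lefschetz_complex K"
    and "discrete_morse_bott K f"
    and "\<mu> \<in> cells K" and "\<kappa> \<in> cells K"
    and "inc K \<mu> \<kappa> \<noteq> 0"
    and "\<And>\<sigma>. \<sigma> \<in> cells K \<Longrightarrow> cdim K \<sigma> = cdim K \<mu> \<or> cdim K \<sigma> = cdim K \<kappa> \<Longrightarrow> f \<sigma> = real (cdim K \<sigma>)"
    and "K\<^sub>E = disjoint_union (cancel_pair K \<mu> \<kappa>) (elementary_block K \<mu> \<kappa>)"
  shows "discrete_morse_bott K\<^sub>E f
    \<and> poincare_series K\<^sub>E = poincare_series K
    \<and> poincare_series (weakly_critical_complex K\<^sub>E f) = poincare_series (weakly_critical_complex K f)
    \<and> remainder_series K f = remainder_series K\<^sub>E f"
proof -
  interpret morse_bott_pair K \<mu> \<kappa> f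
    using assms(1-6) by unfold_locales
  have "discrete_morse_bott K\<^sub>E f"
    using morse_bott lefschetz_split_pair unfolding assms(7) discrete_morse_bott_def
    by (simp add: snc_split_pair)
  moreover have "poincare_series K\<^sub>E = poincare_series K"
    using whole.poincare_series_level by (simp add: assms(7) level_complex_whole)
  moreover have "poincare_series (weakly_critical_complex K\<^sub>E f)
      = poincare_series (weakly_critical_complex K f)"
    unfolding assms(7) weakly_critical_complex_level by (rule critical.poincare_series_level)
  moreover have "d_snc K\<^sub>E f k = d_snc K f k" for k
    unfolding d_snc_def assms(7)
    by (rule arg_cong[where f = card]) (auto simp: kcells_def snc_split_pair)
  moreover have "dim (boundaries K\<^sub>E j) = dim (boundaries K j)" for j
    using whole.dim_boundaries_level by (simp add: assms(7) level_complex_whole)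
  moreover have "dim (boundaries (weakly_critical_complex K\<^sub>E f) j)
      = dim (boundaries (weakly_critical_complex K f) j)" for j
    unfolding assms(7) weakly_critical_complex_level by (rule critical.dim_boundaries_level)
  ultimately show ?thesis by (simp add: remainder_series_def)
qed

end
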